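(* There is an absolute constant $C>0$ such that the following holds. Let $n,N\in\mathbb N$, $m=\frac{n(n+1)}2$, let $\widehat{\mathsf Q}_1,\dots,\widehat{\mathsf Q}_N$ be i.i.d. random matrices in $\mathcal S^n$ with law $\mathbb P_{\rm true}$ such that $\widehat{\boldsymbol\xi}_i=\operatorname{svec}(\widehat{\mathsf Q}_i)\in\mathbb R^m$ are sub-exponential random vectors, and let $\beta\in(0,1)$. (1) With $K:=\max_i\|\widehat{\boldsymbol\xi}_i\|_{\psi_1}$, $$\mathbb P_{\rm true}^N\left[\sup_{\mathbf y\in\mathbb S^{n-1}}\mathbf y^\top\big(\mathbb E_{\widehat{\mathbb P}_N}[\widetilde{\mathsf Q}]-\mathbb E_{\mathbb P_{\rm true}}[\widetilde{\mathsf Q}]\big)\mathbf y\le CK\left(\sqrt{\frac{m+\log(2/\beta)}N}+\frac{m+\log(2/\beta)}N\right)\right]\ge1-\beta.$$ (2) If moreover there is $R>0$ with $\big\|\,\|\widehat{\boldsymbol\xi}_i\|_2\big\|_{\psi_1}\le R$ for all $i\in\{1,\dots,N\}$, then $$\mathbb P_{\rm true}^N\left[\sup_{\mathbf y\in\mathbb S^{n-1}}\mathbf y^\top\big(\mathbb E_{\widehat{\mathbb P}_N}[\widetilde{\mathsf Q}]-\mathbb E_{\mathbb P_{\rm true}}[\widetilde{\mathsf Q}]\big)\mathbf y\le2\sqrt2\,R\sqrt{\frac{2\log(2/\beta)}N}+\frac{R\log(2/\beta)}N\right]\ge1-\beta.$$ (3) If the $\widehat{\boldsymbol\xi}_i$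 are i.i.d. sub-Gaussian random vectors, then with $K:=\max_i\|\widehat{\boldsymbol\xi}_i\|_{\psi_2}$, $$\mathbb P_{\rm true}^N\left[\sup_{\mathbf y\in\mathbb S^{n-1}}\mathbf y^\top\big(\mathbb E_{\widehat{\mathbb P}_N}[\widetilde{\mathsf Q}]-\mathbb E_{\mathbb P_{\rm true}}[\widetilde{\mathsf Q}]\big)\mathbf y\le CK\left(\sqrt{\frac mN}+\sqrt{\frac{\log(2/\beta)}N}\right)\right]\ge1-\beta.$$
   Context: $\mathcal S^n$: real symmetric $n\times n$ matrices. For $\mathsf A=(a_{ij})\in\mathcal S^n$, $\operatorname{svec}(\mathsf A)=(a_{11},\dots,a_{nn},\sqrt2a_{12},\sqrt2a_{13},\dots,\sqrt2a_{n-1,n})^\top\in\mathbb R^m$. For a real random variable $\tilde\xi$ and $q\in\{1,2\}$, $\|\tilde\xi\|_{\psi_q}=\inf\{t>0:\mathbb E[\exp(|\tilde\xi|^q/t^q)]\le2\}$; for a random vector $\tilde{\boldsymbol\xi}\in\mathbb R^m$, $\|\tilde{\boldsymbol\xi}\|_{\psi_q}=\sup_{\mathbf u\in\mathbb S^{m-1}}\|\mathbf u^\top\tilde{\boldsymbol\xi}\|_{\psi_q}$. A random variable or vector is sub-exponential if its $\psi_1$-norm is finite, and sub-Gaussian if its $\psi_2$-norm is finite. $\mathbb S^{k-1}$ is the Euclidean unit sphere in $\mathbb R^k$. $\mathbb P_{\rm true}^N$ is the joint law of the sample, and $\mathbb E_{\widehat{\mathbb P}_N}[\widetilde{\mathsf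 Q}]=\frac1N\sum_{i=1}^N\widehat{\mathsf Q}_i$. *)

theory Defs
  imports "HOL-Probability.Probability" "Jordan_Normal_Form.Matrix"
begin

unbundle no inner_syntax
unbundle no vec_syntax

text \<open>
  The constant in the theorem must not depend on the dimension, so vectors and matrices are
  those with explicit carriers (\<open>carrier_vec\<close>, \<open>carrier_mat\<close>), not the type-indexed ones.
\<close>

definition unit_sphere :: "nat \<Rightarrow> real vec set" where
  "unit_sphere k = {u \<in> carrier_vec k. u \<bullet> u = 1}"

definition l2_norm :: "real vec \<Rightarrow> real" where
  "l2_norm v = sqrt (v \<bullet> v)"

definition sym_mats :: "nat \<Rightarrow> real mat set" where
  "sym_mats n = {A \<in> carrier_mat n n. A\<^sup>T = A}"

text \<open>Since the type \<open>real mat\<close> carries no topology, the Borel sigma-algebra of the symmetric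
  matrices is given as the one generated by the entries.\<close>

definition borel_sym_mats :: "nat \<Rightarrow> real mat measure" where
  "borel_sym_mats n = sigma (sym_mats n)
     {{A \<in> sym_mats n. A $$ (i, j) \<in> B} | i j B. i < n \<and> j < n \<and> B \<in> sets borel}"

definition svec :: "real mat \<Rightarrow> real vec" where
  "svec A = (let n = dim_row A in
     vec_of_list ([A $$ (i, i). i \<leftarrow> [0..<n]] @
                  [sqrt 2 * A $$ (i, j). i \<leftarrow> [0..<n], j \<leftarrow> [Suc i..<n]]))"

text \<open>The Orlicz norms take values in \<open>ennreal\<close>: if no \<open>t\<close> is admissible, the infimum is
  \<open>\<infinity>\<close>, whereas the infimum of the empty set of reals would be an unspecified real number.\<close>

definition psi_norm :: "'a measure \<Rightarrow> nat \<Rightarrow> ('a \<Rightarrow> real) \<Rightarrow> ennreal" where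
  "psi_norm M q X =
     (INF t\<in>{t :: real. 0 < t \<and> (\<integral>\<^sup>+ \<omega>. ennreal (exp (\<bar>X \<omega>\<bar> ^ q / t ^ q)) \<partial>M) \<le> 2}. ennreal t)"

definition psi_norm_vec :: "'a measure \<Rightarrow> nat \<Rightarrow> nat \<Rightarrow> ('a \<Rightarrow> real vec) \<Rightarrow> ennreal" where
  "psi_norm_vec M q m X = (SUP u\<in>unit_sphere m. psi_norm M q (\<lambda>\<omega>. u \<bullet> X \<omega>))"

definition sub_exponential_vec :: "'a measure \<Rightarrow> nat \<Rightarrow> ('a \<Rightarrow> real vec) \<Rightarrow> bool" where
  "sub_exponential_vec M m X \<longleftrightarrow> psi_norm_vec M 1 m X < \<infinity>"

definition sub_gaussian_vec :: "'a measure \<Rightarrow> nat \<Rightarrow> ('a \<Rightarrow> real vec) \<Rightarrow> bool" where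
  "sub_gaussian_vec M m X \<longleftrightarrow> psi_norm_vec M 2 m X < \<infinity>"

text \<open>The joint law of \<open>N\<close> i.i.d. draws from \<open>P\<close>: a sample is a function \<open>\<omega>\<close> on \<open>{1..N}\<close>,
  and the \<open>i\<close>-th random matrix is the coordinate map \<open>\<lambda>\<omega>. \<omega> i\<close>.\<close>

definition sample_law :: "nat \<Rightarrow> real mat measure \<Rightarrow> (nat \<Rightarrow> real mat) measure" where
  "sample_law N P = Pi\<^sub>M {1..N} (\<lambda>_. P)"

definition expectation_mat :: "nat \<Rightarrow> real mat measure \<Rightarrow> real mat" where
  "expectation_mat n P = mat n n (\<lambda>(i, j). \<integral>A. A $$ (i, j) \<partial>P)"

definition empirical_mean :: "nat \<Rightarrow> nat \<Rightarrow> (nat \<Rightarrow> real mat) \<Rightarrow> real mat" where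
  "empirical_mean n N \<omega> = mat n n (\<lambda>(i, j). (\<Sum>k = 1..N. \<omega> k $$ (i, j)) / real N)"

definition sup_deviation :: "nat \<Rightarrow> nat \<Rightarrow> real mat measure \<Rightarrow> (nat \<Rightarrow> real mat) \<Rightarrow> real" where
  "sup_deviation n N P \<omega> =
     (SUP y\<in>unit_sphere n. y \<bullet> ((empirical_mean n N \<omega> - expectation_mat n P) *\<^sub>v y))"

text \<open>The largest Orlicz norm of the vectorized sample matrices, as a real number;
  it is only used where these norms are finite.\<close>

definition max_psi_norm :: "nat \<Rightarrow> nat \<Rightarrow> nat \<Rightarrow> real mat measure \<Rightarrow> real" where
  "max_psi_norm q m N P =
     enn2real (MAX i\<in>{1..N}. psi_norm_vec (sample_law N P) q m (\<lambda>\<omega>. svec (\<omega> i)))"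

lemma space_borel_sym_mats [simp]: "space (borel_sym_mats n) = sym_mats n"
  unfolding borel_sym_mats_def by (rule space_measure_of) auto

lemma measurable_entry:
  assumes "i < n" "j < n"
  shows "(\<lambda>A. A $$ (i, j)) \<in> borel_measurable (borel_sym_mats n)"
proof (rule measurableI)
  fix B :: "real set" assume B: "B \<in> sets borel"
  have "(\<lambda>A. A $$ (i, j)) -` B \<inter> space (borel_sym_mats n) = {A \<in> sym_mats n. A $$ (i, j) \<in> B}"
    by auto
  also have "\<dots> \<in> sets (borel_sym_mats n)"
    unfolding borel_sym_mats_def using assms B by (subst sets_measure_of) auto
  finally show "(\<lambda>A. A $$ (i, j)) -` B \<inter> space (borel_sym_mats n) \<in> sets (borel_sym_mats n)" .
qed auto

lemma svec_carrier:
  assumes "A \<in> carrier_mat n n"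
  shows "svec A \<in> carrier_vec (n * (n + 1) div 2)"
proof -
  have "(\<Sum>i\<leftarrow>[0..<n]. n - Suc i) = (\<Sum>i<n. n - Suc i)"
    by (simp add: interv_sum_list_conv_sum_set_nat atLeast0LessThan)
  also have "\<dots> = (\<Sum>i<n. i)"
    by (rule sum.nat_diff_reindex)
  finally have "n + (\<Sum>i\<leftarrow>[0..<n]. n - Suc i) = n + (\<Sum>i<n. i)"
    by simp
  also have "\<dots> = n * (n + 1) div 2"
    by (induction n) auto
  finally have len: "n + (\<Sum>i\<leftarrow>[0..<n]. n - Suc i) = n * (n + 1) div 2" .
  have "dim_row A = n"
    using assms by simp
  then have "dim_vec (svec A) = n + (\<Sum>i\<leftarrow>[0..<n]. n - Suc i)"
    unfolding svec_def Let_def dim_vec_of_list length_append length_map length_upt length_concat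
      map_map comp_def by simp
  then show ?thesis
    unfolding len by (rule carrier_vecI)
qed

end

theory Submission
  imports Defs
begin

text \<open>
  For a symmetric matrix \<open>M\<close> and a unit vector \<open>y\<close>, the number \<open>y \<bullet> (M *\<^sub>v y)\<close> is the Frobenius
  inner product of \<open>M\<close> with the matrix of the products \<open>y\<^sub>i y\<^sub>j\<close>, which has Frobenius norm 1. As \<open>svec\<close>
  turns this inner product into the Euclidean one (\<open>svec_inner\<close>), the supremum over the sphere is
  at most the Euclidean norm of the centered mean of the vectors \<open>svec Q\<^sub>i\<close> in dimension \<open>m\<close>
  (\<open>quadratic_form_le_centered_sum_norm\<close>). All three bounds are tail bounds for this norm.

  The tail bounds come from one estimate, due to Pinelis: if \<open>S\<close> is a sum of \<open>N\<close> independent copies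
  of a centered random vector \<open>d\<close>, then \<open>E cosh \<parallel>S\<parallel> \<le> (E (exp \<parallel>d\<parallel> - \<parallel>d\<parallel>))\<^sup>N\<close>. Nothing in it depends on
  the dimension. It follows by induction from the deterministic inequality
  \<open>cosh \<parallel>s + d\<parallel> \<le> cosh \<parallel>s\<parallel> (exp \<parallel>d\<parallel> - \<parallel>d\<parallel>) + c \<langle>s, d\<rangle>\<close>, where \<open>c\<close> depends on \<open>s\<close> only, because the
  last term has mean zero. The deterministic inequality holds because \<open>u \<mapsto> cosh (sqrt u)\<close> is
  convex: for given norms of \<open>s\<close> and \<open>d\<close>, the left-hand side is convex and the right-hand side
  affine in \<open>\<langle>s, d\<rangle>\<close>, so it suffices to check collinear \<open>s\<close> and \<open>d\<close>.

  If the norm of the vector has \<open>\<psi>\<^sub>1\<close>-norm at most \<open>R\<close>, then rescaling \<open>d\<close> and applying Markov's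
  inequality gives a Bernstein bound with the explicit constants of the second claim
  (\<open>sub_exponential_tail\<close>). The hypotheses of the first and third claims only
  control the one-dimensional marginals.
  There the Euclidean norm is bounded by the maximum of \<open>\<langle>z, S\<rangle> / sqrt m\<close> over the integer
  vectors \<open>z\<close> with \<open>\<parallel>z\<parallel> \<le> 2 sqrt m\<close>, which number at most \<open>48\<^sup>m\<close>
  (\<open>integer_ball_dominates_L2_set\<close>, \<open>card_integer_ball_le\<close>). The scalar bounds for each \<open>z\<close> and a
  union bound finish the proof, the factor \<open>48\<^sup>m\<close> being absorbed by adding a multiple of \<open>m\<close> to
  \<open>ln (2 / \<beta>)\<close>.

  Two technical points remain. A \<open>\<psi>\<close>-norm is an infimum, so the tail bounds are first obtained for
  every \<open>t\<close> above the norm and then passed to the limit (\<open>tail_at_infimum\<close>), which also covers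
  the case where the norm is 0. And the supremum over the uncountable sphere is measurable because it
  can be tested on integer vectors (\<open>quadratic_form_le_iff_integer\<close>).
\<close>

section \<open>A hyperbolic cosine inequality for Euclidean norms\<close>

text \<open>The power series of this function has only nonnegative coefficients, so it is convex term by
  term, at 0 as well, where the square root is not differentiable.\<close>

lemma convex_on_cosh_sqrt: "convex_on {0..} (\<lambda>u::real. cosh (sqrt u))"
proof (rule convex_onI)
  fix t x y :: real assume t: "0 < t" "t < 1" and xy: "x \<in> {0..}" "y \<in> {0..}"
  define c where "c u n = (if even n then sqrt u ^ n /\<^sub>R fact n else 0)" for u :: real and n :: nat
  have c: "c u sums cosh (sqrt u)" for u
    unfolding c_def by (rule cosh_converges)
  let ?z = "(1 - t) * x + t * y"
  have le: "c ?z n \<le> (1 - t) * c x n + t * c y n" for n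
  proof (cases "even n")
    case True
    then obtain k where n: "n = 2 * k" by (elim evenE)
    have "convex_on {0::real..} (\<lambda>u. u ^ k)"
      by (cases "even k") (auto intro: convex_power_odd convex_on_subset[OF convex_power_even])
    then have pk: "?z ^ k \<le> (1 - t) * x ^ k + t * y ^ k"
      using convex_onD[of "{0..}" "\<lambda>u. u ^ k" t x y] t xy by simp
    have cu: "c u n = u ^ k / fact n" if "0 \<le> u" for u
    proof -
      have "sqrt u ^ (2 * k) = u ^ k"
        using that by (simp only: power_mult real_sqrt_pow2)
      then show ?thesis
        using True by (simp only: c_def n if_True real_scaleR_def divide_inverse mult.commute)
    qed
    have "0 \<le> ?z" using t xy by simp
    then have "c ?z n = ?z ^ k / fact n" by (rule cu)
    also have "\<dots> \<le> ((1 - t) * x ^ k + t * y ^ k) / fact n"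
      using pk by (rule divide_right_mono) simp
    also have "\<dots> = (1 - t) * c x n + t * c y n"
      using xy cu[of x] cu[of y] by (simp add: add_divide_distrib)
    finally show ?thesis .
  qed (simp add: c_def)
  have "(\<lambda>n. (1 - t) * c x n + t * c y n) sums
      ((1 - t) * cosh (sqrt x) + t * cosh (sqrt y))"
    by (intro sums_add sums_mult c)
  from sums_le[OF le c this]
  show "cosh (sqrt ((1 - t) *\<^sub>R x + t *\<^sub>R y)) \<le>
      (1 - t) * cosh (sqrt x) + t * cosh (sqrt y)"
    by simp
qed simp

lemma le_sinh: "0 \<le> b \<Longrightarrow> b \<le> sinh (b::real)"
  using real_le_x_sinh[of b] by (simp add: sinh_field_def exp_minus)

text \<open>Here \<open>a\<close> and \<open>b\<close> are the norms of two vectors and \<open>p\<close> is their inner product. By convexity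
  in \<open>p\<close> only \<open>p = a * b\<close> and \<open>p = - (a * b)\<close> matter, where the left-hand side is \<open>cosh (a + b)\<close> or
  \<open>cosh (a - b)\<close>, and these two cases reduce to \<open>b \<le> sinh b\<close> and \<open>sinh a \<le> cosh a\<close>. For \<open>a = 0\<close> the
  last term vanishes, as division by 0 gives 0 and \<open>p\<close> is 0 as well.\<close>

lemma cosh_law_of_cosines_le:
  fixes a b p :: real
  assumes a: "0 \<le> a" and b: "0 \<le> b" and p: "\<bar>p\<bar> \<le> a * b"
  shows "cosh (sqrt (a\<^sup>2 + 2 * p + b\<^sup>2)) \<le> cosh a * (exp b - b) + sinh a / a * p"
proof -
  have s: "b \<le> sinh b" using b by (rule le_sinh)
  have eb: "exp b = cosh b + sinh b" by (simp add: cosh_plus_sinh)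
  have sa: "0 \<le> sinh a" "sinh a \<le> cosh a" "0 < cosh a"
    using a by (auto simp: sinh_le_cosh_real cosh_real_pos)
  have sp: "sinh a * (sinh b - b) \<le> cosh a * (sinh b - b)"
    using sa s by (intro mult_right_mono) auto
  have sm: "0 \<le> sinh a * (sinh b - b)"
    using sa s by simp
  have plus: "cosh (a + b) \<le> cosh a * (exp b - b) + sinh a * b"
    using sp by (simp add: cosh_add eb algebra_simps)
  have minus: "cosh (a - b) \<le> cosh a * (exp b - b) - sinh a * b"
    using sp sm by (simp add: cosh_diff eb algebra_simps)
  show ?thesis
  proof (cases "a * b = 0")
    case True
    then consider "a = 0" | "b = 0" by auto
    then show ?thesis
    proof cases
      assume "a = 0"
      then show ?thesis using plus p b by simp
    next
      assume "b = 0"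
      then show ?thesis using plus p a by simp
    qed
  next
    case False
    then have ab: "0 < a" "0 < b" using a b by auto
    define t where "t = (p + a * b) / (2 * (a * b))"
    have ab0: "0 < a * b" using ab by simp
    have t: "0 \<le> t" "t \<le> 1" using p ab0 by (auto simp: t_def field_simps)
    have pt: "p = (2 * t - 1) * (a * b)" using ab by (simp add: t_def field_simps)
    have "a\<^sup>2 + 2 * p + b\<^sup>2 = (1 - t) * (a - b)\<^sup>2 + t * (a + b)\<^sup>2"
      unfolding pt by (simp add: power2_eq_square algebra_simps)
    then have "cosh (sqrt (a\<^sup>2 + 2 * p + b\<^sup>2)) \<le> (1 - t) * cosh (a - b) + t * cosh (a + b)"
      using convex_onD[OF convex_on_cosh_sqrt, of t "(a - b)\<^sup>2" "(a + b)\<^sup>2"] t ab by simp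
    also have "\<dots> \<le> (1 - t) * (cosh a * (exp b - b) - sinh a * b)
        + t * (cosh a * (exp b - b) + sinh a * b)"
      using t plus minus by (intro add_mono mult_left_mono) auto
    also have "\<dots> = cosh a * (exp b - b) + sinh a / a * p"
      using ab unfolding pt by (simp add: field_simps)
    finally show ?thesis .
  qed
qed

lemma cosh_L2_set_add_le:
  fixes s d :: "'j \<Rightarrow> real"
  shows "cosh (L2_set (\<lambda>j. s j + d j) J) \<le>
    cosh (L2_set s J) * (exp (L2_set d J) - L2_set d J)
      + sinh (L2_set s J) / L2_set s J * (\<Sum>j\<in>J. s j * d j)"
proof -
  have "\<bar>\<Sum>j\<in>J. s j * d j\<bar> \<le> (\<Sum>j\<in>J. \<bar>s j\<bar> * \<bar>d j\<bar>)"
    by (rule order.trans[OF sum_abs]) (simp add: abs_mult)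
  also have "\<dots> \<le> L2_set s J * L2_set d J"
    by (rule L2_set_mult_ineq)
  finally have p: "\<bar>\<Sum>j\<in>J. s j * d j\<bar> \<le> L2_set s J * L2_set d J" .
  have "(\<Sum>j\<in>J. (s j + d j)\<^sup>2) = (\<Sum>j\<in>J. (s j)\<^sup>2) + 2 * (\<Sum>j\<in>J. s j * d j) + (\<Sum>j\<in>J. (d j)\<^sup>2)"
    by (simp add: power2_sum sum.distrib sum_distrib_left algebra_simps)
  also have "\<dots> = (L2_set s J)\<^sup>2 + 2 * (\<Sum>j\<in>J. s j * d j) + (L2_set d J)\<^sup>2"
    by (simp add: L2_set_def sum_nonneg)
  finally have "L2_set (\<lambda>j. s j + d j) J =
      sqrt ((L2_set s J)\<^sup>2 + 2 * (\<Sum>j\<in>J. s j * d j) + (L2_set d J)\<^sup>2)"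
    by (simp add: L2_set_def)
  then show ?thesis
    using cosh_law_of_cosines_le[OF L2_set_nonneg L2_set_nonneg p] by simp
qed

text \<open>The expansion of \<open>exp (l * x) - 1 - l * x\<close> starts with the second power of \<open>l\<close>; for \<open>l\<close> at
  most 1 each term is at most \<open>l\<^sup>2\<close> times the corresponding term for \<open>l = 1\<close>.\<close>

lemma exp_minus_self_le:
  fixes l x :: real
  assumes l: "0 \<le> l" "l \<le> 1" and x: "0 \<le> x"
  shows "exp (l * x) - l * x \<le> 1 + l\<^sup>2 * exp x"
proof -
  have a: "(\<lambda>n. (l * x) ^ (n + 2) /\<^sub>R fact (n + 2)) sums (exp (l * x) - (1 + l * x))"
    for l using sums_split_initial_segment[OF exp_converges[of "l * x"], of 2]
    by (simp add: numeral_2_eq_2)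
  have "l ^ (n + 2) * (x ^ (n + 2) / fact (n + 2)) \<le> l\<^sup>2 * (x ^ (n + 2) / fact (n + 2))" for n
    using l x by (intro mult_right_mono power_decreasing) auto
  then have "(l * x) ^ (n + 2) /\<^sub>R fact (n + 2) \<le> l\<^sup>2 * ((1 * x) ^ (n + 2) /\<^sub>R fact (n + 2))" for n
    by (simp add: power_mult_distrib field_simps)
  from sums_le[OF this a sums_mult[OF a]]
  have "exp (l * x) - (1 + l * x) \<le> l\<^sup>2 * (exp x - (1 + x))" by simp
  also have "\<dots> \<le> l\<^sup>2 * exp x" using x by (intro mult_left_mono) auto
  finally show ?thesis by simp
qed

section \<open>Exponential moments of the norm of a centered i.i.d. sum\<close>

lemma borel_measurable_L2_set [measurable]:
  assumes "\<And>j. j \<in> J \<Longrightarrow> f j \<in> borel_measurable M"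
  shows "(\<lambda>x. L2_set (\<lambda>j. f j x) J) \<in> borel_measurable M"
  unfolding L2_set_def using assms by measurable

lemma L2_set_scale: "0 \<le> c \<Longrightarrow> L2_set (\<lambda>j. c * f j) J = c * L2_set f J"
  by (simp add: L2_set_right_distrib)

text \<open>One step of the induction over the sample: \<open>s\<close> is the sum so far. The term of the pointwise
  inequality that is linear in \<open>D\<close> integrates to 0.\<close>

lemma nn_integral_cosh_add_le:
  fixes D :: "'j \<Rightarrow> 'a \<Rightarrow> real"
  assumes D: "\<And>j. j \<in> J \<Longrightarrow> integrable P (D j)" "\<And>j. j \<in> J \<Longrightarrow> (\<integral>x. D j x \<partial>P) = 0"
    and h: "0 \<le> h"
      "(\<integral>\<^sup>+ x. ennreal (exp (L2_set (\<lambda>j. D j x) J) - L2_set (\<lambda>j. D j x) J) \<partial>P) \<le> ennreal h"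
  shows "(\<integral>\<^sup>+ x. ennreal (cosh (L2_set (\<lambda>j. s j + D j x) J)) \<partial>P) \<le> ennreal (cosh (L2_set s J) * h)"
proof -
  define g where "g x = exp (L2_set (\<lambda>j. D j x) J) - L2_set (\<lambda>j. D j x) J" for x
  have [measurable]: "D j \<in> borel_measurable P" if "j \<in> J" for j
    using D(1)[OF that] by simp
  have g0: "0 \<le> g x" for x
    using exp_ge_add_one_self[of "L2_set (\<lambda>j. D j x) J"] unfolding g_def by linarith
  have gm [measurable]: "g \<in> borel_measurable P"
    unfolding g_def by measurable
  have gi: "integrable P g"
    using h(2) g0 by (intro integrableI_nonneg)
      (auto simp: g_def[symmetric] intro: le_less_trans)
  have gh: "(\<integral>x. g x \<partial>P) \<le> h"
    using h g0 nn_integral_eq_integral[OF gi] by (simp add: g_def[symmetric])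
  let ?c = "sinh (L2_set s J) / L2_set s J"
  have "(\<integral>\<^sup>+ x. ennreal (cosh (L2_set (\<lambda>j. s j + D j x) J)) \<partial>P) \<le>
      (\<integral>\<^sup>+ x. ennreal (cosh (L2_set s J) * g x + ?c * (\<Sum>j\<in>J. s j * D j x)) \<partial>P)"
    unfolding g_def by (intro nn_integral_mono ennreal_leI cosh_L2_set_add_le)
  also have "\<dots> = ennreal (\<integral>x. cosh (L2_set s J) * g x + ?c * (\<Sum>j\<in>J. s j * D j x) \<partial>P)"
  proof (intro nn_integral_eq_integral AE_I2)
    fix x
    have "0 \<le> cosh (L2_set (\<lambda>j. s j + D j x) J)"
      by (rule cosh_real_nonneg)
    then show "0 \<le> cosh (L2_set s J) * g x + ?c * (\<Sum>j\<in>J. s j * D j x)"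
      unfolding g_def using cosh_L2_set_add_le by (rule order.trans)
  qed (intro Bochner_Integration.integrable_add integrable_mult_right gi
      Bochner_Integration.integrable_sum D)
  also have "(\<integral>x. cosh (L2_set s J) * g x + ?c * (\<Sum>j\<in>J. s j * D j x) \<partial>P) =
      cosh (L2_set s J) * (\<integral>x. g x \<partial>P)"
    using D gi by (simp add: integral_sum)
  also have "ennreal \<dots> \<le> ennreal (cosh (L2_set s J) * h)"
    using gh by (intro ennreal_leI mult_left_mono) (auto simp: cosh_real_nonneg)
  finally show ?thesis .
qed

lemma nn_integral_cosh_sum_le:
  fixes D :: "'j \<Rightarrow> 'a \<Rightarrow> real" and I :: "'i set"
  assumes "prob_space P" and I: "finite I"
    and D: "\<And>j. j \<in> J \<Longrightarrow> integrable P (D j)" "\<And>j. j \<in> J \<Longrightarrow> (\<integral>x. D j x \<partial>P) = 0"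
    and h: "0 \<le> h"
      "(\<integral>\<^sup>+ x. ennreal (exp (L2_set (\<lambda>j. D j x) J) - L2_set (\<lambda>j. D j x) J) \<partial>P) \<le> ennreal h"
  shows "(\<integral>\<^sup>+ \<omega>. ennreal (cosh (L2_set (\<lambda>j. \<Sum>i\<in>I. D j (\<omega> i)) J)) \<partial>Pi\<^sub>M I (\<lambda>_. P)) \<le> ennreal (h ^ card I)"
proof -
  interpret prob_space P by fact
  interpret product_sigma_finite "\<lambda>_::'i. P" ..
  have Dm [measurable]: "D j \<in> borel_measurable P" if "j \<in> J" for j
    using D(1)[OF that] by simp
  show ?thesis
    using I
  proof (induction I)
    case empty
    interpret e: prob_space "Pi\<^sub>M {} (\<lambda>_::'i. P)"
      by (intro prob_space_PiM assms(1))
    show ?case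
      by (simp add: e.emeasure_space_1 L2_set_def)
  next
    case (insert k I)
    have m [measurable]: "(\<lambda>\<omega>. cosh (L2_set (\<lambda>j. \<Sum>i\<in>F. D j (\<omega> i)) J)) \<in> borel_measurable (Pi\<^sub>M F (\<lambda>_. P))"
      for F :: "'i set"
    proof -
      have "(\<lambda>\<omega>. D j (\<omega> i)) \<in> borel_measurable (Pi\<^sub>M F (\<lambda>_. P))" if "i \<in> F" "j \<in> J" for i j
        using measurable_component_singleton[OF that(1), of "\<lambda>_. P"] Dm[OF that(2)]
        by (rule measurable_compose)
      then show ?thesis
        by (intro borel_measurable_continuous_on[OF continuous_on_cosh[OF continuous_on_id]]
            borel_measurable_L2_set borel_measurable_sum)
    qed
    have "(\<integral>\<^sup>+ \<omega>. ennreal (cosh (L2_set (\<lambda>j. \<Sum>i\<in>insert k I. D j (\<omega> i)) J)) \<partial>Pi\<^sub>M (insert k I) (\<lambda>_. P)) =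
        (\<integral>\<^sup>+ \<omega>. (\<integral>\<^sup>+ x. ennreal (cosh (L2_set (\<lambda>j. \<Sum>i\<in>insert k I. D j (fun_upd \<omega> k x i)) J)) \<partial>P) \<partial>Pi\<^sub>M I (\<lambda>_. P))"
      using insert.hyps by (intro product_nn_integral_insert measurable_compose[OF m measurable_ennreal])
    also have "\<dots> \<le> (\<integral>\<^sup>+ \<omega>. ennreal (cosh (L2_set (\<lambda>j. \<Sum>i\<in>I. D j (\<omega> i)) J)) * ennreal h \<partial>Pi\<^sub>M I (\<lambda>_. P))"
    proof (rule nn_integral_mono)
      fix \<omega> :: "'i \<Rightarrow> 'a"
      have "(\<Sum>i\<in>insert k I. D j (fun_upd \<omega> k x i)) = (\<Sum>i\<in>I. D j (\<omega> i)) + D j x" for j x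
      proof -
        have "(\<Sum>i\<in>I. D j (fun_upd \<omega> k x i)) = (\<Sum>i\<in>I. D j (\<omega> i))"
          using insert.hyps by (intro sum.cong) auto
        then show ?thesis using insert.hyps by simp
      qed
      then show "(\<integral>\<^sup>+ x. ennreal (cosh (L2_set (\<lambda>j. \<Sum>i\<in>insert k I. D j (fun_upd \<omega> k x i)) J)) \<partial>P) \<le>
          ennreal (cosh (L2_set (\<lambda>j. \<Sum>i\<in>I. D j (\<omega> i)) J)) * ennreal h"
        using nn_integral_cosh_add_le[OF D h, of "\<lambda>j. \<Sum>i\<in>I. D j (\<omega> i)"]
        by (simp add: ennreal_mult' h(1) ennreal_mult'' )
    qed
    also have "\<dots> = (\<integral>\<^sup>+ \<omega>. ennreal (cosh (L2_set (\<lambda>j. \<Sum>i\<in>I. D j (\<omega> i)) J)) \<partial>Pi\<^sub>M I (\<lambda>_. P)) * ennreal h"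
      by (rule nn_integral_multc) measurable
    also have "\<dots> \<le> ennreal (h ^ card I) * ennreal h"
      using insert.IH by (rule mult_right_mono) simp
    also have "\<dots> = ennreal (h ^ card (insert k I))"
      using insert.hyps h(1) by (simp add: ennreal_mult'' mult.commute)
    finally show ?case .
  qed
qed

definition centered_sum_norm ::
    "'a measure \<Rightarrow> 'j set \<Rightarrow> ('j \<Rightarrow> 'a \<Rightarrow> real) \<Rightarrow> 'i set \<Rightarrow> ('i \<Rightarrow> 'a) \<Rightarrow> real" where
  "centered_sum_norm P J X I \<omega> = L2_set (\<lambda>j. \<Sum>i\<in>I. (X j (\<omega> i) - (\<integral>x. X j x \<partial>P))) J"

lemma measurable_centered_sum_norm [measurable]:
  assumes "\<And>j. j \<in> J \<Longrightarrow> X j \<in> borel_measurable P"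
  shows "centered_sum_norm P J X I \<in> borel_measurable (Pi\<^sub>M I (\<lambda>_. P))"
proof -
  have "(\<lambda>\<omega>. X j (\<omega> i)) \<in> borel_measurable (Pi\<^sub>M I (\<lambda>_. P))" if "i \<in> I" "j \<in> J" for i j
    using measurable_component_singleton[OF that(1), of "\<lambda>_. P"] assms[OF that(2)]
    by (rule measurable_compose)
  then show ?thesis
    unfolding centered_sum_norm_def
    by (intro borel_measurable_L2_set borel_measurable_sum borel_measurable_diff borel_measurable_const)
qed

text \<open>Markov's inequality for \<open>cosh\<close> of the norm; the factor 2 comes from \<open>exp x \<le> 2 * cosh x\<close>.\<close>

lemma centered_sum_norm_tail:
  fixes X :: "'j \<Rightarrow> 'a \<Rightarrow> real" and I :: "'i set"
  assumes "prob_space P" and I: "finite I" and l: "0 \<le> l"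
    and X: "\<And>j. j \<in> J \<Longrightarrow> integrable P (X j)"
    and h: "0 \<le> h"
      "(\<integral>\<^sup>+ x. ennreal (exp (l * L2_set (\<lambda>j. X j x - (\<integral>x. X j x \<partial>P)) J)
        - l * L2_set (\<lambda>j. X j x - (\<integral>x. X j x \<partial>P)) J) \<partial>P) \<le> ennreal h"
  shows "measure (Pi\<^sub>M I (\<lambda>_. P)) {\<omega> \<in> space (Pi\<^sub>M I (\<lambda>_. P)). \<tau> < centered_sum_norm P J X I \<omega>}
    \<le> 2 * exp (- l * \<tau>) * h ^ card I"
proof -
  interpret prob_space P by fact
  interpret N: prob_space "Pi\<^sub>M I (\<lambda>_. P)"
    by (intro prob_space_PiM assms(1))
  define D where "D j x = l * (X j x - (\<integral>x. X j x \<partial>P))" for j x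
  let ?S = "centered_sum_norm P J X I"
  have Xm [measurable]: "X j \<in> borel_measurable P" if "j \<in> J" for j
    using X[OF that] by simp
  have D: "integrable P (D j)" "(\<integral>x. D j x \<partial>P) = 0" if "j \<in> J" for j
    unfolding D_def using X[OF that] by (auto simp: prob_space)
  have lD: "L2_set (\<lambda>j. D j x) J = l * L2_set (\<lambda>j. X j x - (\<integral>x. X j x \<partial>P)) J" for x
    unfolding D_def using l by (rule L2_set_scale)
  have lS: "L2_set (\<lambda>j. \<Sum>i\<in>I. D j (\<omega> i)) J = l * ?S \<omega>" for \<omega> :: "'i \<Rightarrow> 'a"
    unfolding D_def centered_sum_norm_def sum_distrib_left[symmetric] using l by (rule L2_set_scale)
  have Sm [measurable]: "?S \<in> borel_measurable (Pi\<^sub>M I (\<lambda>_. P))"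
    by (rule measurable_centered_sum_norm) (rule Xm)
  have "emeasure (Pi\<^sub>M I (\<lambda>_. P)) {\<omega> \<in> space (Pi\<^sub>M I (\<lambda>_. P)). \<tau> < ?S \<omega>} =
      (\<integral>\<^sup>+ \<omega>. indicator {\<omega> \<in> space (Pi\<^sub>M I (\<lambda>_. P)). \<tau> < ?S \<omega>} \<omega> \<partial>Pi\<^sub>M I (\<lambda>_. P))"
    by simp
  also have "\<dots> \<le> (\<integral>\<^sup>+ \<omega>. ennreal (2 * exp (- l * \<tau>)) * ennreal (cosh (l * ?S \<omega>)) \<partial>Pi\<^sub>M I (\<lambda>_. P))"
  proof (rule nn_integral_mono)
    fix \<omega> :: "'i \<Rightarrow> 'a"
    have "1 \<le> 2 * exp (- l * \<tau>) * cosh (l * ?S \<omega>)" if "\<tau> < ?S \<omega>"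
    proof -
      have "1 \<le> exp (- l * \<tau> + l * ?S \<omega>)"
        using l that by (simp add: mult_left_mono)
      also have "\<dots> = exp (- l * \<tau>) * exp (l * ?S \<omega>)"
        by (rule exp_add)
      also have "exp (l * ?S \<omega>) \<le> 2 * cosh (l * ?S \<omega>)"
        by (simp add: cosh_field_def)
      finally show ?thesis by (simp add: mult_left_mono mult_ac)
    qed
    then show "indicator {\<omega> \<in> space (Pi\<^sub>M I (\<lambda>_. P)). \<tau> < ?S \<omega>} \<omega> \<le>
        ennreal (2 * exp (- l * \<tau>)) * ennreal (cosh (l * ?S \<omega>))"
      by (auto simp: indicator_def ennreal_mult'[symmetric] simp flip: ennreal_1)
  qed
  also have "\<dots> = ennreal (2 * exp (- l * \<tau>)) * (\<integral>\<^sup>+ \<omega>. ennreal (cosh (l * ?S \<omega>)) \<partial>Pi\<^sub>M I (\<lambda>_. P))"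
    by (intro nn_integral_cmult measurable_compose[OF _ measurable_ennreal]
        borel_measurable_continuous_on[OF continuous_on_cosh[OF continuous_on_id]]) measurable
  also have "\<dots> \<le> ennreal (2 * exp (- l * \<tau>)) * ennreal (h ^ card I)"
    using nn_integral_cosh_sum_le[where P = P and D = D and J = J, OF assms(1) I D h(1)] h(2)
    unfolding lD lS by (intro mult_left_mono) auto
  also have "\<dots> = ennreal (2 * exp (- l * \<tau>) * h ^ card I)"
    using h(1) by (simp add: ennreal_mult)
  finally show ?thesis
    using h(1) by (simp add: N.emeasure_eq_measure)
qed

section \<open>Tail bounds under a bound on the Orlicz norm of the norm\<close>

text \<open>Jensen's inequality for the Euclidean norm, obtained by pairing \<open>X\<close> with its mean vector and
  using the Cauchy-Schwarz inequality.\<close>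

lemma L2_set_expectation_le:
  assumes X: "\<And>j. j \<in> J \<Longrightarrow> integrable P (X j)" and J: "finite J"
  shows "integrable P (\<lambda>x. L2_set (\<lambda>j. X j x) J)"
    and "L2_set (\<lambda>j. \<integral>x. X j x \<partial>P) J \<le> (\<integral>x. L2_set (\<lambda>j. X j x) J \<partial>P)"
proof -
  have Xm [measurable]: "X j \<in> borel_measurable P" if "j \<in> J" for j
    using X[OF that] by simp
  have "integrable P (\<lambda>x. \<Sum>j\<in>J. \<bar>X j x\<bar>)"
    by (intro Bochner_Integration.integrable_sum integrable_abs X)
  then show int: "integrable P (\<lambda>x. L2_set (\<lambda>j. X j x) J)"
    by (rule Bochner_Integration.integrable_bound)
      (auto simp: sum_nonneg intro!: L2_set_le_sum_abs)
  let ?v = "\<lambda>j. \<integral>x. X j x \<partial>P"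
  have "L2_set ?v J * L2_set ?v J = (\<Sum>j\<in>J. ?v j * ?v j)"
    by (simp add: L2_set_def sum_nonneg flip: power2_eq_square)
  also have "\<dots> = (\<integral>x. (\<Sum>j\<in>J. ?v j * X j x) \<partial>P)"
    using X by (simp add: integral_sum)
  also have "\<dots> \<le> (\<integral>x. L2_set ?v J * L2_set (\<lambda>j. X j x) J \<partial>P)"
  proof (intro integral_mono Bochner_Integration.integrable_sum integrable_mult_right X int)
    fix x
    have "(\<Sum>j\<in>J. ?v j * X j x) \<le> (\<Sum>j\<in>J. \<bar>?v j\<bar> * \<bar>X j x\<bar>)"
      by (intro sum_mono) (simp add: abs_mult[symmetric])
    also have "\<dots> \<le> L2_set ?v J * L2_set (\<lambda>j. X j x) J"
      by (rule L2_set_mult_ineq)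
    finally show "(\<Sum>j\<in>J. ?v j * X j x) \<le> L2_set ?v J * L2_set (\<lambda>j. X j x) J" .
  qed
  also have "\<dots> = L2_set ?v J * (\<integral>x. L2_set (\<lambda>j. X j x) J \<partial>P)"
    by simp
  finally have "L2_set ?v J * L2_set ?v J \<le> L2_set ?v J * (\<integral>x. L2_set (\<lambda>j. X j x) J \<partial>P)" .
  moreover have "0 \<le> (\<integral>x. L2_set (\<lambda>j. X j x) J \<partial>P)" by simp
  ultimately show "L2_set ?v J \<le> (\<integral>x. L2_set (\<lambda>j. X j x) J \<partial>P)"
    using L2_set_nonneg[of ?v J] by (cases "L2_set ?v J = 0") (auto simp: mult_le_cancel_left)
qed

text \<open>Centering squares the exponential moment: it changes the norm by at most the mean of the norm,
  and \<open>exp\<close> of this mean is at most the exponential moment itself, by Jensen's inequality.\<close>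

lemma nn_integral_exp_centered_le:
  fixes X :: "'j \<Rightarrow> 'a \<Rightarrow> real"
  assumes "prob_space P" and J: "finite J" and l: "0 \<le> l"
    and X: "\<And>j. j \<in> J \<Longrightarrow> integrable P (X j)"
    and c: "0 \<le> c" "(\<integral>\<^sup>+ x. ennreal (exp (l * L2_set (\<lambda>j. X j x) J)) \<partial>P) \<le> ennreal c"
  shows "(\<integral>\<^sup>+ x. ennreal (exp (l * L2_set (\<lambda>j. X j x - (\<integral>x. X j x \<partial>P)) J)) \<partial>P) \<le> ennreal (c * c)"
proof -
  interpret prob_space P by fact
  define Y where "Y x = L2_set (\<lambda>j. X j x) J" for x
  define a where "a = (\<integral>x. Y x \<partial>P)"
  have Yi: "integrable P Y"
    unfolding Y_def using L2_set_expectation_le[OF X J] by simp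
  have [measurable]: "Y \<in> borel_measurable P" using Yi by simp
  have mean: "L2_set (\<lambda>j. \<integral>x. X j x \<partial>P) J \<le> a"
    unfolding a_def Y_def using L2_set_expectation_le[OF X J] by simp
  have dev: "L2_set (\<lambda>j. X j x - (\<integral>x. X j x \<partial>P)) J \<le> Y x + a" for x
  proof -
    have "L2_set (\<lambda>j. X j x + - (\<integral>x. X j x \<partial>P)) J \<le>
        L2_set (\<lambda>j. X j x) J + L2_set (\<lambda>j. - (\<integral>x. X j x \<partial>P)) J"
      by (rule L2_set_triangle_ineq)
    moreover have "L2_set (\<lambda>j. - (\<integral>x. X j x \<partial>P)) J = L2_set (\<lambda>j. (\<integral>x. X j x \<partial>P)) J"
      by (simp add: L2_set_def)
    ultimately show ?thesis using mean by (simp add: Y_def)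
  qed
  have ei: "integrable P (\<lambda>x. exp (l * Y x))"
    using c by (intro integrableI_nonneg) (auto simp: Y_def[symmetric] intro: le_less_trans)
  have ec: "(\<integral>x. exp (l * Y x) \<partial>P) \<le> c"
    using c nn_integral_eq_integral[OF ei] by (simp add: Y_def[symmetric])
  have "exp (l * a) \<le> (\<integral>x. exp (l * Y x) \<partial>P)"
    using jensens_inequality[where X = "\<lambda>x. l * Y x" and I = UNIV and q = exp] Yi ei exp_convex by (simp add: a_def)
  then have la: "exp (l * a) \<le> c" using ec by simp
  have "(\<integral>\<^sup>+ x. ennreal (exp (l * L2_set (\<lambda>j. X j x - (\<integral>x. X j x \<partial>P)) J)) \<partial>P) \<le>
      (\<integral>\<^sup>+ x. ennreal (exp (l * Y x)) * ennreal (exp (l * a)) \<partial>P)"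
    using mult_left_mono[OF dev l]
    by (intro nn_integral_mono) (simp add: ennreal_mult'[symmetric] exp_add[symmetric] distrib_left)
  also have "\<dots> = (\<integral>\<^sup>+ x. ennreal (exp (l * Y x)) \<partial>P) * ennreal (exp (l * a))"
    by (rule nn_integral_multc) measurable
  also have "\<dots> \<le> ennreal c * ennreal c"
    using c la by (intro mult_mono) (auto simp: Y_def intro: ennreal_leI)
  finally show ?thesis using c(1) by (simp add: ennreal_mult)
qed

lemma nn_integral_exp_minus_self_le:
  assumes "prob_space P" and d: "d \<in> borel_measurable P" "\<And>x. 0 \<le> d x" and l: "0 \<le> l" "l \<le> 1"
    and c: "0 \<le> c" "(\<integral>\<^sup>+ x. ennreal (exp (d x)) \<partial>P) \<le> ennreal c"
  shows "(\<integral>\<^sup>+ x. ennreal (exp (l * d x) - l * d x) \<partial>P) \<le> ennreal (exp (c * l\<^sup>2))"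
proof -
  interpret prob_space P by fact
  note [measurable] = d(1)
  have "(\<integral>\<^sup>+ x. ennreal (exp (l * d x) - l * d x) \<partial>P) \<le> (\<integral>\<^sup>+ x. 1 + ennreal (l\<^sup>2) * ennreal (exp (d x)) \<partial>P)"
  proof (rule nn_integral_mono)
    fix x
    have "ennreal (exp (l * d x) - l * d x) \<le> ennreal (1 + l\<^sup>2 * exp (d x))"
      by (intro ennreal_leI exp_minus_self_le l d)
    then show "ennreal (exp (l * d x) - l * d x) \<le> 1 + ennreal (l\<^sup>2) * ennreal (exp (d x))"
      by (simp add: ennreal_plus ennreal_mult)
  qed
  also have "\<dots> = 1 + ennreal (l\<^sup>2) * (\<integral>\<^sup>+ x. ennreal (exp (d x)) \<partial>P)"
    by (simp add: nn_integral_add nn_integral_cmult emeasure_space_1)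
  also have "\<dots> \<le> 1 + ennreal (l\<^sup>2) * ennreal c"
    using c by (intro add_left_mono mult_left_mono) auto
  also have "\<dots> = ennreal (1 + c * l\<^sup>2)"
    using c(1) by (simp add: ennreal_plus ennreal_mult mult.commute)
  also have "\<dots> \<le> ennreal (exp (c * l\<^sup>2))"
    by (rule ennreal_leI[OF exp_ge_add_one_self])
  finally show ?thesis .
qed

text \<open>Centering turns the bound 2 on the exponential moment into 4, and this 4 gives the factor
  \<open>exp (4 * l\<^sup>2)\<close> per observation. The exact constants 4 and 1 in the threshold are what the explicit
  bound in terms of \<open>R\<close> needs, as \<open>2 * sqrt 2 * sqrt 2 = 4\<close>.\<close>

lemma sub_exponential_tail:
  fixes X :: "'j \<Rightarrow> 'a \<Rightarrow> real" and I :: "'i set" and L :: real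
  assumes "prob_space P" and I: "finite I" "I \<noteq> {}" and J: "finite J" and t: "0 < t" and L: "0 < L"
    and X: "\<And>j. j \<in> J \<Longrightarrow> integrable P (X j)"
    and orlicz: "(\<integral>\<^sup>+ x. ennreal (exp (L2_set (\<lambda>j. X j x) J / t)) \<partial>P) \<le> 2"
  shows "measure (Pi\<^sub>M I (\<lambda>_. P)) {\<omega> \<in> space (Pi\<^sub>M I (\<lambda>_. P)).
      real (card I) * (t * (4 * sqrt (L / card I) + L / card I)) < centered_sum_norm P J X I \<omega>}
    \<le> 2 * exp (- L)"
proof -
  have Xm [measurable]: "X j \<in> borel_measurable P" if "j \<in> J" for j
    using X[OF that] by simp
  define N where "N = real (card I)"
  have N: "0 < N" using I by (simp add: N_def card_gt_0_iff)
  define w where "w = sqrt L"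
  define s where "s = sqrt N"
  have ws: "0 < w" "0 < s" using L N by (auto simp: w_def s_def)
  have LN: "L = w\<^sup>2" "N = s\<^sup>2" using L N by (auto simp: w_def s_def)
  \<comment> \<open>With this choice \<open>4 * s\<^sup>2 * l\<^sup>2 / (1 - l)\<close>, the bound usual in Bernstein's inequality, makes the
    exponent equal to \<open>- L\<close>; the smaller \<open>4 * s\<^sup>2 * l\<^sup>2\<close> suffices a fortiori.\<close>
  define l where "l = w / (w + 2 * s)"
  have l: "0 \<le> l" "l \<le> 1" using ws by (auto simp: l_def)
  define d where "d x = L2_set (\<lambda>j. X j x - (\<integral>x. X j x \<partial>P)) J / t" for x
  have "(\<integral>\<^sup>+ x. ennreal (exp (d x)) \<partial>P) \<le> ennreal (2 * 2)"
    using nn_integral_exp_centered_le[where X = X, OF assms(1) J _ X, of "1 / t" 2] t orlicz by (simp add: d_def)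
  then have "(\<integral>\<^sup>+ x. ennreal (exp (l * d x) - l * d x) \<partial>P) \<le> ennreal (exp (4 * l\<^sup>2))"
    using t l by (intro nn_integral_exp_minus_self_le[OF assms(1)]) (auto simp: d_def)
  then have "measure (Pi\<^sub>M I (\<lambda>_. P)) {\<omega> \<in> space (Pi\<^sub>M I (\<lambda>_. P)).
      N * (t * (4 * sqrt (L / N) + L / N)) < centered_sum_norm P J X I \<omega>} \<le>
      2 * exp (- (l / t) * (N * (t * (4 * sqrt (L / N) + L / N)))) * exp (4 * l\<^sup>2) ^ card I"
    using t l by (intro centered_sum_norm_tail[OF assms(1) I(1)]) (auto simp: X d_def)
  also have "\<dots> = 2 * exp (4 * s\<^sup>2 * l\<^sup>2 - l * (4 * w * s + w\<^sup>2))"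
  proof -
    have NT: "N * (4 * sqrt (L / N) + L / N) = 4 * w * s + w\<^sup>2"
      using ws by (simp add: LN real_sqrt_divide power2_eq_square field_simps)
    have "- (l / t) * (N * (t * (4 * sqrt (L / N) + L / N))) = - l * (N * (4 * sqrt (L / N) + L / N))"
      using t by (simp only: mult.left_commute[of N t]) simp
    then have "- (l / t) * (N * (t * (4 * sqrt (L / N) + L / N))) = - l * (4 * w * s + w\<^sup>2)"
      unfolding NT .
    moreover have "exp (4 * l\<^sup>2) ^ card I = exp (4 * s\<^sup>2 * l\<^sup>2)"
      by (simp add: exp_of_nat_mult[symmetric] LN(2)[symmetric] N_def mult_ac)
    ultimately show ?thesis by (simp add: exp_add[symmetric] exp_diff field_simps exp_minus)
  qed
  also have "\<dots> \<le> 2 * exp (- L)"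
  proof -
    have "l * (w + 2 * s) = w" using ws by (simp add: l_def)
    then have e: "w * (1 - l) = 2 * s * l" by (simp add: algebra_simps)
    have "w\<^sup>2 + 4 * s\<^sup>2 * l\<^sup>2 - l * (4 * w * s + w\<^sup>2) =
        w * (w * (1 - l)) + (2 * s * l)\<^sup>2 - 4 * w * s * l"
      by (simp add: power2_eq_square algebra_simps)
    also have "\<dots> = (2 * s * l) * (w * (1 - l)) - 2 * s * l * w"
      unfolding e by (simp add: power2_eq_square e[symmetric] algebra_simps)
    also have "\<dots> = - (2 * s * w * l\<^sup>2)"
      by (simp add: power2_eq_square algebra_simps)
    also have "\<dots> \<le> 0" using ws by simp
    finally show ?thesis by (simp add: LN)
  qed
  finally show ?thesis unfolding N_def .
qed

text \<open>The moment bound \<open>exp (8 * l\<^sup>2)\<close> holds for all \<open>l\<close>, which is why no linear term appears. For \<open>l\<close>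
  at most 1 it follows from the second-order remainder of \<open>exp\<close>. For larger \<open>l\<close> the negative
  linear term can be dropped, since \<open>r * w \<le> w\<^sup>2 + r\<^sup>2 / 4\<close> already gives a quadratic exponent and
  the constant factor 4 is at most \<open>exp (2 * l\<^sup>2)\<close>.\<close>

lemma sub_gaussian_tail:
  fixes X :: "'j \<Rightarrow> 'a \<Rightarrow> real" and I :: "'i set" and L :: real
  assumes "prob_space P" and I: "finite I" "I \<noteq> {}" and J: "finite J" and t: "0 < t" and L: "0 < L"
    and X: "\<And>j. j \<in> J \<Longrightarrow> integrable P (X j)"
    and orlicz: "(\<integral>\<^sup>+ x. ennreal (exp ((L2_set (\<lambda>j. X j x) J)\<^sup>2 / t\<^sup>2)) \<partial>P) \<le> 2"
  shows "measure (Pi\<^sub>M I (\<lambda>_. P)) {\<omega> \<in> space (Pi\<^sub>M I (\<lambda>_. P)).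
      real (card I) * (t * (6 * sqrt (L / card I))) < centered_sum_norm P J X I \<omega>}
    \<le> 2 * exp (- L)"
proof -
  have Xm [measurable]: "X j \<in> borel_measurable P" if "j \<in> J" for j
    using X[OF that] by simp
  define N where "N = real (card I)"
  have N: "0 < N" using I by (simp add: N_def card_gt_0_iff)
  \<comment> \<open>The minimizer of \<open>8 * l\<^sup>2 - 6 * l * sqrt (L / N)\<close>.\<close>
  define l where "l = sqrt (L / N) * (3 / 8)"
  have l: "0 \<le> l" using L N by (auto simp: l_def)
  define d where "d x = L2_set (\<lambda>j. X j x - (\<integral>x. X j x \<partial>P)) J / t" for x
  have d0: "0 \<le> d x" for x using t by (simp add: d_def)
  have exp_W: "(\<integral>\<^sup>+ x. ennreal (exp (r / t * L2_set (\<lambda>j. X j x) J)) \<partial>P) \<le> ennreal (2 * exp (r\<^sup>2 / 4))" for r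
  proof -
    have "(\<integral>\<^sup>+ x. ennreal (exp (r / t * L2_set (\<lambda>j. X j x) J)) \<partial>P) \<le>
        (\<integral>\<^sup>+ x. ennreal (exp ((L2_set (\<lambda>j. X j x) J)\<^sup>2 / t\<^sup>2)) * ennreal (exp (r\<^sup>2 / 4)) \<partial>P)"
    proof (rule nn_integral_mono)
      fix x
      have "0 \<le> (r / 2 - L2_set (\<lambda>j. X j x) J / t)\<^sup>2" by simp
      then have "r / t * L2_set (\<lambda>j. X j x) J \<le> (L2_set (\<lambda>j. X j x) J)\<^sup>2 / t\<^sup>2 + r\<^sup>2 / 4"
        by (simp add: power2_eq_square algebra_simps)
      then show "ennreal (exp (r / t * L2_set (\<lambda>j. X j x) J)) \<le>
          ennreal (exp ((L2_set (\<lambda>j. X j x) J)\<^sup>2 / t\<^sup>2)) * ennreal (exp (r\<^sup>2 / 4))"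
        by (simp add: ennreal_mult'[symmetric] exp_add[symmetric])
    qed
    also have "\<dots> = (\<integral>\<^sup>+ x. ennreal (exp ((L2_set (\<lambda>j. X j x) J)\<^sup>2 / t\<^sup>2)) \<partial>P) * ennreal (exp (r\<^sup>2 / 4))"
      by (rule nn_integral_multc) measurable
    also have "\<dots> \<le> 2 * ennreal (exp (r\<^sup>2 / 4))"
      using orlicz by (rule mult_right_mono) simp
    finally show ?thesis by (simp add: ennreal_mult)
  qed
  have exp_d: "(\<integral>\<^sup>+ x. ennreal (exp (r * d x)) \<partial>P) \<le> ennreal (4 * exp (r\<^sup>2 / 2))" if r: "0 \<le> r" for r
  proof -
    have "(\<integral>\<^sup>+ x. ennreal (exp (r / t * L2_set (\<lambda>j. X j x - (\<integral>x. X j x \<partial>P)) J)) \<partial>P)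
        \<le> ennreal ((2 * exp (r\<^sup>2 / 4)) * (2 * exp (r\<^sup>2 / 4)))"
      using r t by (intro nn_integral_exp_centered_le[where X = X, OF assms(1) J _ X] exp_W) auto
    moreover have "(2 * exp (r\<^sup>2 / 4)) * (2 * exp (r\<^sup>2 / 4)) = 4 * exp (r\<^sup>2 / 2)"
      by (simp add: exp_add[symmetric])
    ultimately show ?thesis by (simp add: d_def)
  qed
  have "(\<integral>\<^sup>+ x. ennreal (exp (l * d x) - l * d x) \<partial>P) \<le> ennreal (exp (8 * l\<^sup>2))"
  proof (cases "l \<le> 1")
    case True
    have "(exp (1 / 2 :: real))\<^sup>2 \<le> 2\<^sup>2"
      using exp_le by (simp add: power2_eq_square exp_add[symmetric])
    then have "exp (1 / 2 :: real) \<le> 2"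
      by (rule power2_le_imp_le) simp
    then have "ennreal (4 * exp (1\<^sup>2 / 2)) \<le> ennreal 8"
      by (intro ennreal_leI) simp
    then have "(\<integral>\<^sup>+ x. ennreal (exp (d x)) \<partial>P) \<le> ennreal 8"
      using exp_d[of 1] by (auto intro: order.trans)
    then show ?thesis
      using True l d0 by (intro nn_integral_exp_minus_self_le[OF assms(1)]) (auto simp: d_def)
  next
    case False
    have "(\<integral>\<^sup>+ x. ennreal (exp (l * d x) - l * d x) \<partial>P) \<le> (\<integral>\<^sup>+ x. ennreal (exp (l * d x)) \<partial>P)"
      using l d0 by (intro nn_integral_mono ennreal_leI) simp
    also have "\<dots> \<le> ennreal (4 * exp (l\<^sup>2 / 2))"
      using l by (rule exp_d)
    also have "\<dots> \<le> ennreal (exp (8 * l\<^sup>2))"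
    proof (rule ennreal_leI)
      have "(2::real) \<le> exp 1" using exp_ge_add_one_self[of 1] by simp
      then have "4 \<le> exp (2::real)"
        using mult_mono[of 2 "exp 1" 2 "exp (1::real)"] by (simp add: exp_add[symmetric])
      moreover have "1 \<le> l\<^sup>2" using False by (simp add: one_le_power)
      ultimately have "4 * exp (l\<^sup>2 / 2) \<le> exp (2 * l\<^sup>2) * exp (l\<^sup>2 / 2)"
        by (intro mult_right_mono) (auto intro: order.trans)
      also have "\<dots> \<le> exp (8 * l\<^sup>2)"
        by (simp add: exp_add[symmetric])
      finally show "4 * exp (l\<^sup>2 / 2) \<le> exp (8 * l\<^sup>2)" .
    qed
    finally show ?thesis .
  qed
  then have "measure (Pi\<^sub>M I (\<lambda>_. P)) {\<omega> \<in> space (Pi\<^sub>M I (\<lambda>_. P)).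
      N * (t * (6 * sqrt (L / N))) < centered_sum_norm P J X I \<omega>} \<le>
      2 * exp (- (l / t) * (N * (t * (6 * sqrt (L / N))))) * exp (8 * l\<^sup>2) ^ card I"
    using t l by (intro centered_sum_norm_tail[OF assms(1) I(1)]) (auto simp: X d_def)
  also have "\<dots> = 2 * exp (8 * N * l\<^sup>2 - 6 * N * l * sqrt (L / N))"
    using t by (simp add: exp_of_nat_mult[symmetric] N_def exp_diff exp_minus field_simps)
  also have "8 * N * l\<^sup>2 - 6 * N * l * sqrt (L / N) = - (9 / 8) * L"
  proof -
    define q where "q = sqrt (L / N)"
    have "q * q = L / N" using L N by (simp add: q_def)
    then have "N * (q * q) = L" using N by simp
    then show ?thesis
      unfolding l_def q_def[symmetric] by (simp add: power2_eq_square algebra_simps)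
  qed
  also have "2 * exp (- (9 / 8) * L) \<le> 2 * exp (- L)"
    using L by simp
  finally show ?thesis unfolding N_def .
qed

section \<open>Integer nets and tail bounds from one-dimensional marginals\<close>

definition integer_ball :: "'j set \<Rightarrow> ('j \<Rightarrow> int) set" where
  "integer_ball J = {z \<in> J \<rightarrow>\<^sub>E UNIV. (\<Sum>j\<in>J. (z j)\<^sup>2) \<le> 4 * int (card J)}"

lemma sum_two_sided_geometric_le:
  "(\<Sum>k\<in>{- int n..int n}. (1 / 2 :: real) ^ nat \<bar>k\<bar>) \<le> 3"
proof -
  have "(\<Sum>k\<in>{- int n..int n}. (1 / 2 :: real) ^ nat \<bar>k\<bar>) = 3 - 2 * (1 / 2) ^ n"
  proof (induction n)
    case (Suc n)
    have "{- int (Suc n)..int (Suc n)} = insert (int (Suc n)) (insert (- int (Suc n)) {- int n..int n})"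
      by auto
    moreover have "nat (int n + 1) = Suc n" "nat (1 + int n) = Suc n" by simp_all
    ultimately show ?case using Suc by simp
  qed simp
  then show ?thesis by simp
qed

text \<open>The vectors are counted with the weight \<open>(1/2)\<close> to the sum of the \<open>\<bar>z j\<bar>\<close>. It is at least
  \<open>(1/16) ^ m\<close> on the ball, as \<open>\<bar>k\<bar> \<le> k\<^sup>2\<close> for integers, and its total over all integer vectors is at
  most \<open>3 ^ m\<close>, being a product of one-dimensional sums.\<close>

lemma card_integer_ball_le:
  assumes J: "finite J"
  shows "finite (integer_ball J)" and "real (card (integer_ball J)) \<le> 48 ^ card J"
proof -
  define m where "m = card J"
  define B where "B = {- int (4 * m)..int (4 * m)}"
  have abs_le: "\<bar>k\<bar> \<le> k\<^sup>2" for k :: int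
  proof (cases "k = 0")
    case False
    then have "\<bar>k\<bar> * 1 \<le> \<bar>k\<bar> * \<bar>k\<bar>" by (intro mult_left_mono) auto
    then show ?thesis by (simp add: power2_eq_square)
  qed simp
  have sum_le: "(\<Sum>j\<in>J. \<bar>z j\<bar>) \<le> 4 * int m" if "z \<in> integer_ball J" for z
    using that sum_mono[of J "\<lambda>j. \<bar>z j\<bar>" "\<lambda>j. (z j)\<^sup>2"] abs_le by (auto simp: integer_ball_def m_def)
  have sub: "integer_ball J \<subseteq> J \<rightarrow>\<^sub>E B"
  proof
    fix z assume z: "z \<in> integer_ball J"
    have "z j \<in> B" if "j \<in> J" for j
    proof -
      have "\<bar>z j\<bar> \<le> 4 * int m"
        using member_le_sum[of j J "\<lambda>j. \<bar>z j\<bar>"] J that sum_le[OF z] by simp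
      then show ?thesis unfolding B_def abs_le_iff atLeastAtMost_iff by simp
    qed
    then show "z \<in> J \<rightarrow>\<^sub>E B"
      using z by (simp add: integer_ball_def PiE_iff)
  qed
  have fin: "finite (J \<rightarrow>\<^sub>E B)"
    using J by (intro finite_PiE) (auto simp: B_def)
  then show finb: "finite (integer_ball J)"
    using sub finite_subset by blast
  let ?w = "\<lambda>z. \<Prod>j\<in>J. (1 / 2 :: real) ^ nat \<bar>z j\<bar>"
  have w: "(1 / 16) ^ m \<le> ?w z" if "z \<in> integer_ball J" for z
  proof -
    have "int (\<Sum>j\<in>J. nat \<bar>z j\<bar>) \<le> int (4 * m)" using sum_le[OF that] by simp
    then have "(\<Sum>j\<in>J. nat \<bar>z j\<bar>) \<le> 4 * m" by (simp only: of_nat_le_iff)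
    then have "(1 / 2 :: real) ^ (4 * m) \<le> (1 / 2) ^ (\<Sum>j\<in>J. nat \<bar>z j\<bar>)"
      by (intro power_decreasing) auto
    then show ?thesis by (simp add: power_mult power_sum power_one_over)
  qed
  have "real (card (integer_ball J)) * (1 / 16) ^ m = (\<Sum>z\<in>integer_ball J. (1 / 16) ^ m)"
    by simp
  also have "\<dots> \<le> (\<Sum>z\<in>integer_ball J. ?w z)"
    by (intro sum_mono w)
  also have "\<dots> \<le> (\<Sum>z\<in>J \<rightarrow>\<^sub>E B. ?w z)"
    using fin sub by (intro sum_mono2) (auto intro: prod_nonneg)
  also have "\<dots> = (\<Prod>j\<in>J. \<Sum>k\<in>B. (1 / 2) ^ nat \<bar>k\<bar>)"
    using J by (subst prod_sum_PiE) (auto simp: B_def)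
  also have "\<dots> \<le> 3 ^ m"
    unfolding prod_constant m_def[symmetric] B_def
    by (intro power_mono sum_two_sided_geometric_le sum_nonneg) simp
  finally have "real (card (integer_ball J)) \<le> 3 ^ m * 16 ^ m"
    by (simp add: power_one_over field_simps)
  then show "real (card (integer_ball J)) \<le> 48 ^ card J"
    by (simp add: m_def power_mult_distrib[symmetric])
qed

text \<open>Take the vector in the direction of \<open>S\<close> with norm \<open>sqrt m\<close> and round each coordinate away from 0.
  This can only increase the inner product with \<open>S\<close>, and as each coordinate moves by at most 1, the
  squared norm stays below \<open>2 * m + 2 * m\<close>.\<close>

lemma integer_ball_dominates_L2_set:
  fixes S :: "'j \<Rightarrow> real"
  assumes J: "finite J"
  shows "\<exists>z\<in>integer_ball J. sqrt (card J) * L2_set S J \<le> (\<Sum>j\<in>J. real_of_int (z j) * S j)"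
proof (cases "L2_set S J = 0")
  case True
  then have "(\<lambda>j\<in>J. 0) \<in> integer_ball J"
    by (auto simp: integer_ball_def)
  moreover have "sqrt (card J) * L2_set S J \<le> (\<Sum>j\<in>J. real_of_int ((\<lambda>j\<in>J. 0) j) * S j)"
    using True by simp
  ultimately show ?thesis by blast
next
  case False
  define r where "r = L2_set S J"
  have r: "0 < r" using False L2_set_nonneg[of S J] by (simp add: r_def less_le)
  have r2: "(\<Sum>j\<in>J. (S j)\<^sup>2) = r\<^sup>2" by (simp add: r_def L2_set_def sum_nonneg)
  define x where "x j = sqrt (card J) * S j / r" for j
  have sx: "(\<Sum>j\<in>J. (x j)\<^sup>2) = card J"
    using r by (simp add: x_def power_divide power_mult_distrib r2 flip: sum_divide_distrib sum_distrib_left)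
  define z where "z = (\<lambda>j\<in>J. if 0 \<le> S j then \<lceil>x j\<rceil> else \<lfloor>x j\<rfloor>)"
  have zx: "\<bar>real_of_int (z j) - x j\<bar> \<le> 1" if "j \<in> J" for j
    using that by (auto simp: z_def) linarith+
  have "real_of_int (\<Sum>j\<in>J. (z j)\<^sup>2) = (\<Sum>j\<in>J. (real_of_int (z j))\<^sup>2)"
    by simp
  also have "\<dots> \<le> (\<Sum>j\<in>J. 2 * (x j)\<^sup>2 + 2)"
  proof (intro sum_mono)
    fix j assume j: "j \<in> J"
    let ?e = "real_of_int (z j) - x j"
    have "?e\<^sup>2 \<le> 1" using zx[OF j] by (simp add: abs_square_le_1)
    moreover have "0 \<le> (x j - ?e)\<^sup>2" by simp
    moreover have "(real_of_int (z j))\<^sup>2 = 2 * (x j)\<^sup>2 + 2 * ?e\<^sup>2 - (x j - ?e)\<^sup>2"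
      by (simp add: power2_eq_square algebra_simps)
    ultimately show "(real_of_int (z j))\<^sup>2 \<le> 2 * (x j)\<^sup>2 + 2" by linarith
  qed
  also have "\<dots> = real_of_int (4 * int (card J))"
    by (simp add: sum.distrib sx flip: sum_distrib_left)
  finally have "z \<in> integer_ball J"
    unfolding of_int_le_iff by (auto simp: integer_ball_def z_def)
  moreover have "sqrt (card J) * L2_set S J \<le> (\<Sum>j\<in>J. real_of_int (z j) * S j)"
  proof -
    have "sqrt (card J) * L2_set S J = sqrt (card J) / r * (\<Sum>j\<in>J. (S j)\<^sup>2)"
      using r unfolding r2 by (simp add: r_def[symmetric] power2_eq_square)
    also have "\<dots> = (\<Sum>j\<in>J. x j * S j)"
      by (simp add: x_def power2_eq_square sum_distrib_left mult.assoc)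
    also have "\<dots> \<le> (\<Sum>j\<in>J. real_of_int (z j) * S j)"
    proof (rule sum_mono)
      fix j assume j: "j \<in> J"
      show "x j * S j \<le> real_of_int (z j) * S j"
      proof (cases "0 \<le> S j")
        case True
        with j show ?thesis by (simp add: z_def mult_right_mono)
      next
        case False
        with j show ?thesis by (simp add: z_def mult_right_mono_neg)
      qed
    qed
    finally show ?thesis .
  qed
  ultimately show ?thesis by blast
qed

lemma centered_sum_norm_tail_net:
  fixes X :: "'j \<Rightarrow> 'a \<Rightarrow> real" and I :: "'i set"
  assumes P: "prob_space P" and J: "finite J" "J \<noteq> {}"
    and X: "\<And>j. j \<in> J \<Longrightarrow> integrable P (X j)"
    and q: "\<And>z. z \<in> integer_ball J \<Longrightarrow>
      measure (Pi\<^sub>M I (\<lambda>_. P)) {\<omega> \<in> space (Pi\<^sub>M I (\<lambda>_. P)).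
        sqrt (card J) * \<tau> < centered_sum_norm P {()} (\<lambda>_ x. \<Sum>j\<in>J. real_of_int (z j) * X j x) I \<omega>} \<le> q"
  shows "measure (Pi\<^sub>M I (\<lambda>_. P)) {\<omega> \<in> space (Pi\<^sub>M I (\<lambda>_. P)). \<tau> < centered_sum_norm P J X I \<omega>}
    \<le> 48 ^ card J * q"
proof -
  interpret N: prob_space "Pi\<^sub>M I (\<lambda>_. P)"
    by (intro prob_space_PiM P)
  let ?Y = "\<lambda>z x. \<Sum>j\<in>J. real_of_int (z j) * X j x"
  let ?E = "\<lambda>z. {\<omega> \<in> space (Pi\<^sub>M I (\<lambda>_. P)).
    sqrt (card J) * \<tau> < centered_sum_norm P {()} (\<lambda>_. ?Y z) I \<omega>}"
  have Ym: "?Y z \<in> borel_measurable P" for z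
    using X by (intro borel_measurable_sum borel_measurable_times borel_measurable_const
        borel_measurable_integrable)
  have E [measurable]: "?E z \<in> sets (Pi\<^sub>M I (\<lambda>_. P))" for z
    using measurable_centered_sum_norm[of "{()}" "\<lambda>_. ?Y z" P I] Ym by measurable
  have "{\<omega> \<in> space (Pi\<^sub>M I (\<lambda>_. P)). \<tau> < centered_sum_norm P J X I \<omega>} \<subseteq> (\<Union>z\<in>integer_ball J. ?E z)"
  proof
    fix \<omega> assume w: "\<omega> \<in> {\<omega> \<in> space (Pi\<^sub>M I (\<lambda>_. P)). \<tau> < centered_sum_norm P J X I \<omega>}"
    let ?S = "\<lambda>j. \<Sum>i\<in>I. (X j (\<omega> i) - (\<integral>x. X j x \<partial>P))"
    obtain z where z: "z \<in> integer_ball J"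
        "sqrt (card J) * L2_set ?S J \<le> (\<Sum>j\<in>J. real_of_int (z j) * ?S j)"
      using integer_ball_dominates_L2_set[OF J(1), of ?S] by blast
    have "sqrt (card J) * \<tau> < sqrt (card J) * L2_set ?S J"
      using w J by (simp add: centered_sum_norm_def card_gt_0_iff)
    also note z(2)
    also have "(\<Sum>j\<in>J. real_of_int (z j) * ?S j) =
        (\<Sum>j\<in>J. \<Sum>i\<in>I. real_of_int (z j) * X j (\<omega> i) - real_of_int (z j) * (\<integral>x. X j x \<partial>P))"
      by (simp add: sum_distrib_left right_diff_distrib)
    also have "\<dots> = (\<Sum>i\<in>I. \<Sum>j\<in>J. real_of_int (z j) * X j (\<omega> i) - real_of_int (z j) * (\<integral>x. X j x \<partial>P))"
      by (rule sum.swap)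
    also have "\<dots> = (\<Sum>i\<in>I. (?Y z (\<omega> i) - (\<integral>x. ?Y z x \<partial>P)))"
      using X by (simp add: sum_subtractf integral_sum)
    also have "\<dots> \<le> centered_sum_norm P {()} (\<lambda>_. ?Y z) I \<omega>"
      by (simp add: centered_sum_norm_def)
    finally show "\<omega> \<in> (\<Union>z\<in>integer_ball J. ?E z)"
      using w z(1) by auto
  qed
  then have "measure (Pi\<^sub>M I (\<lambda>_. P)) {\<omega> \<in> space (Pi\<^sub>M I (\<lambda>_. P)). \<tau> < centered_sum_norm P J X I \<omega>} \<le>
      measure (Pi\<^sub>M I (\<lambda>_. P)) (\<Union>z\<in>integer_ball J. ?E z)"
    using card_integer_ball_le(1)[OF J(1)] by (intro N.finite_measure_mono sets.finite_UN) auto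
  also have "\<dots> \<le> (\<Sum>z\<in>integer_ball J. measure (Pi\<^sub>M I (\<lambda>_. P)) (?E z))"
    using card_integer_ball_le(1)[OF J(1)] by (intro N.finite_measure_subadditive_finite) auto
  also have "\<dots> \<le> (\<Sum>z\<in>integer_ball J. q)"
    by (intro sum_mono q)
  also have "\<dots> = card (integer_ball J) * q" by simp
  also have "\<dots> \<le> 48 ^ card J * q"
  proof (rule mult_right_mono)
    obtain z where "z \<in> integer_ball J"
      using integer_ball_dominates_L2_set[OF J(1)] by blast
    from q[OF this] show "0 \<le> q" using measure_nonneg by (rule order.trans[rotated])
  qed (rule card_integer_ball_le(2)[OF J(1)])
  finally show ?thesis .
qed

text \<open>The vectors of the ball have norm at most \<open>2 * sqrt m\<close>, so this is the assumption on unit vectors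
  after rescaling.\<close>

lemma orlicz_integer_ball:
  fixes X :: "'j \<Rightarrow> 'a \<Rightarrow> real"
  assumes P: "prob_space P" and J: "finite J" "J \<noteq> {}" and t: "0 < t" and q: "0 < q"
    and orlicz: "\<And>u. L2_set u J = 1 \<Longrightarrow>
      (\<integral>\<^sup>+ x. ennreal (exp (\<bar>\<Sum>j\<in>J. u j * X j x\<bar> ^ q / t ^ q)) \<partial>P) \<le> 2"
    and z: "z \<in> integer_ball J"
  shows "(\<integral>\<^sup>+ x. ennreal (exp (\<bar>\<Sum>j\<in>J. real_of_int (z j) * X j x\<bar> ^ q / (2 * sqrt (card J) * t) ^ q)) \<partial>P) \<le> 2"
proof -
  interpret prob_space P by fact
  define r where "r = L2_set (\<lambda>j. real_of_int (z j)) J"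
  show ?thesis
  proof (cases "r = 0")
    case True
    then have "real_of_int (z j) = 0" if "j \<in> J" for j
      using L2_set_eq_0_iff[OF J(1), of "\<lambda>j. real_of_int (z j)"] that by (simp add: r_def)
    then show ?thesis using q by (simp add: emeasure_space_1 power_0_left)
  next
    case False
    then have r: "0 < r" using L2_set_nonneg[of "\<lambda>j. real_of_int (z j)" J] by (simp add: r_def less_le)
    have "real_of_int (\<Sum>j\<in>J. (z j)\<^sup>2) \<le> real_of_int (4 * int (card J))"
      using z by (simp only: of_int_le_iff integer_ball_def mem_Collect_eq)
    then have "(\<Sum>j\<in>J. (real_of_int (z j))\<^sup>2) \<le> 4 * real (card J)"
      by simp
    then have "r \<le> sqrt (4 * real (card J))"
      unfolding r_def L2_set_def by (rule real_sqrt_le_mono)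
    then have r2: "r \<le> 2 * sqrt (card J)"
      by (simp only: real_sqrt_mult real_sqrt_four)
    define u where "u j = 1 / r * real_of_int (z j)" for j
    have "L2_set u J = 1"
      using r unfolding u_def by (subst L2_set_scale) (auto simp: r_def[symmetric])
    have "(\<integral>\<^sup>+ x. ennreal (exp (\<bar>\<Sum>j\<in>J. real_of_int (z j) * X j x\<bar> ^ q / (2 * sqrt (card J) * t) ^ q)) \<partial>P)
        \<le> (\<integral>\<^sup>+ x. ennreal (exp (\<bar>\<Sum>j\<in>J. u j * X j x\<bar> ^ q / t ^ q)) \<partial>P)"
    proof (intro nn_integral_mono ennreal_leI)
      fix x
      let ?y = "\<Sum>j\<in>J. real_of_int (z j) * X j x"
      have "(\<Sum>j\<in>J. u j * X j x) = 1 / r * ?y"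
        by (simp add: u_def sum_distrib_left mult.assoc)
      then have "\<bar>\<Sum>j\<in>J. u j * X j x\<bar> = \<bar>?y\<bar> / r" using r by (simp add: abs_mult)
      moreover have "\<bar>?y\<bar> / (2 * sqrt (card J) * t) \<le> \<bar>?y\<bar> / r / t"
      proof -
        have "r * t \<le> 2 * sqrt (card J) * t" using r2 t by (intro mult_right_mono) auto
        then show ?thesis
          unfolding divide_divide_eq_left using r t J
          by (intro divide_left_mono mult_pos_pos) (auto simp: card_gt_0_iff)
      qed
      ultimately have "(\<bar>?y\<bar> / (2 * sqrt (card J) * t)) ^ q \<le> (\<bar>\<Sum>j\<in>J. u j * X j x\<bar> / t) ^ q"
        using t by (intro power_mono) auto
      then show "exp (\<bar>?y\<bar> ^ q / (2 * sqrt (card J) * t) ^ q) \<le> exp (\<bar>\<Sum>j\<in>J. u j * X j x\<bar> ^ q / t ^ q)"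
        by (simp add: power_divide)
    qed
    also have "\<dots> \<le> 2" by (rule orlicz) fact
    finally show ?thesis .
  qed
qed

text \<open>Raising the exponent from \<open>L\<close> to \<open>L + m * ln 48\<close> pays for a union bound over \<open>48 ^ m\<close> events and
  costs only a constant factor in \<open>m + L\<close>.\<close>

lemma net_union_bound:
  fixes L :: real
  shows "48 ^ m * (2 * exp (- (L + real m * ln 48))) = 2 * exp (- L)"
    and "0 \<le> L \<Longrightarrow> L + real m * ln 48 \<le> 9 * (real m + L)"
proof -
  have "exp (real m * ln 48) = 48 ^ m"
    by (simp add: exp_of_nat_mult)
  moreover have "exp (- (L + real m * ln 48)) = exp (- L) / exp (real m * ln 48)"
    unfolding exp_diff[symmetric] by simp
  ultimately show "48 ^ m * (2 * exp (- (L + real m * ln 48))) = 2 * exp (- L)"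
    by simp
  have "2 ^ 6 \<le> exp (1::real) ^ 6"
    using exp_ge_add_one_self[of 1] by (intro power_mono) auto
  also have "exp (1::real) ^ 6 = exp 6"
    by (simp add: exp_of_nat_mult[symmetric])
  finally have "ln 48 \<le> ln (exp (6::real))" by (subst ln_le_cancel_iff) auto
  then have "real m * ln 48 \<le> real m * 6" by (intro mult_left_mono) auto
  then show "L + real m * ln 48 \<le> 9 * (real m + L)" if "0 \<le> L" using that by simp
qed

text \<open>The factor \<open>2 * sqrt m\<close> in the Orlicz norm of \<open>\<langle>z, X\<rangle>\<close> cancels against the \<open>sqrt m\<close> gained in passing
  from the norm to the net, so no dimensional factor other than the \<open>m\<close> next to \<open>L\<close> is left.\<close>

lemma sub_exponential_norm_tail:
  fixes X :: "'j \<Rightarrow> 'a \<Rightarrow> real" and I :: "'i set" and L :: real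
  assumes P: "prob_space P" and I: "finite I" "I \<noteq> {}" and J: "finite J" "J \<noteq> {}"
    and t: "0 < t" and L: "0 < L"
    and X: "\<And>j. j \<in> J \<Longrightarrow> integrable P (X j)"
    and orlicz: "\<And>u. L2_set u J = 1 \<Longrightarrow>
      (\<integral>\<^sup>+ x. ennreal (exp (\<bar>\<Sum>j\<in>J. u j * X j x\<bar> ^ 1 / t ^ 1)) \<partial>P) \<le> 2"
  shows "measure (Pi\<^sub>M I (\<lambda>_. P)) {\<omega> \<in> space (Pi\<^sub>M I (\<lambda>_. P)).
      real (card I) * (36 * t * (sqrt ((card J + L) / card I) + (card J + L) / card I))
        < centered_sum_norm P J X I \<omega>} \<le> 2 * exp (- L)"
proof -
  interpret N: prob_space "Pi\<^sub>M I (\<lambda>_. P)"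
    by (intro prob_space_PiM P)
  define N where "N = real (card I)"
  have N: "0 < N" using I by (simp add: N_def card_gt_0_iff)
  define m where "m = card J"
  have m: "0 < real m" using J by (simp add: m_def card_gt_0_iff)
  define L' where "L' = L + real m * ln 48"
  have L': "0 < L'" using L by (simp add: L'_def add_pos_nonneg)
  have L'_le: "L' \<le> 9 * (real m + L)" using net_union_bound(2)[of L m] L by (simp add: L'_def)
  define \<tau> where "\<tau> = N * (36 * t * (sqrt ((m + L) / N) + (m + L) / N))"
  have "4 * sqrt (L' / N) + L' / N \<le> 4 * (3 * sqrt ((m + L) / N)) + 9 * ((m + L) / N)"
  proof (intro add_mono mult_left_mono)
    have "sqrt (L' / N) \<le> sqrt (9 * ((m + L) / N))"
      using L'_le N by (intro real_sqrt_le_mono) (simp add: divide_right_mono)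
    then show "sqrt (L' / N) \<le> 3 * sqrt ((m + L) / N)" by (simp only: real_sqrt_mult) simp
  qed (use L'_le N in \<open>auto simp: divide_right_mono\<close>)
  also have "\<dots> \<le> 18 * (sqrt ((m + L) / N) + (m + L) / N)"
  proof -
    have "0 \<le> sqrt ((m + L) / N)" "0 \<le> (m + L) / N" using m L N by auto
    then show ?thesis by (simp only: distrib_left)
  qed
  finally have "2 * (sqrt m * (N * t)) * (4 * sqrt (L' / N) + L' / N) \<le>
      2 * (sqrt m * (N * t)) * (18 * (sqrt ((m + L) / N) + (m + L) / N))"
    using N t by (intro mult_left_mono) auto
  then have \<tau>: "N * ((2 * sqrt m * t) * (4 * sqrt (L' / N) + L' / N)) \<le> sqrt m * \<tau>"
    by (simp add: \<tau>_def mult_ac)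
  have "measure (Pi\<^sub>M I (\<lambda>_. P)) {\<omega> \<in> space (Pi\<^sub>M I (\<lambda>_. P)). \<tau> < centered_sum_norm P J X I \<omega>}
      \<le> 48 ^ card J * (2 * exp (- L'))"
  proof (rule centered_sum_norm_tail_net[OF P J X])
    fix z assume z: "z \<in> integer_ball J"
    define Y where "Y x = (\<Sum>j\<in>J. real_of_int (z j) * X j x)" for x
    have Y: "integrable P Y"
      unfolding Y_def using X by (intro Bochner_Integration.integrable_sum integrable_mult_right)
    have "measure (Pi\<^sub>M I (\<lambda>_. P)) {\<omega> \<in> space (Pi\<^sub>M I (\<lambda>_. P)).
        sqrt m * \<tau> < centered_sum_norm P {()} (\<lambda>_. Y) I \<omega>} \<le>
      measure (Pi\<^sub>M I (\<lambda>_. P)) {\<omega> \<in> space (Pi\<^sub>M I (\<lambda>_. P)).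
        N * ((2 * sqrt m * t) * (4 * sqrt (L' / N) + L' / N)) < centered_sum_norm P {()} (\<lambda>_. Y) I \<omega>}"
      using measurable_centered_sum_norm[of "{()}" "\<lambda>_. Y" P I] Y \<tau>
      by (intro N.finite_measure_mono) auto
    also have "\<dots> \<le> 2 * exp (- L')"
      unfolding N_def
      using orlicz_integer_ball[where q = 1, OF P J t _ orlicz z] Y m t L'
      by (intro sub_exponential_tail P I) (auto simp: Y_def m_def)
    finally show "measure (Pi\<^sub>M I (\<lambda>_. P)) {\<omega> \<in> space (Pi\<^sub>M I (\<lambda>_. P)).
        sqrt (card J) * \<tau> < centered_sum_norm P {()} (\<lambda>_ x. \<Sum>j\<in>J. real_of_int (z j) * X j x) I \<omega>}
      \<le> 2 * exp (- L')"
      by (simp only: Y_def[abs_def] m_def)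
  qed
  also have "\<dots> = 2 * exp (- L)"
    unfolding L'_def m_def by (rule net_union_bound)
  finally show ?thesis by (simp only: \<tau>_def N_def m_def)
qed

lemma sub_gaussian_norm_tail:
  fixes X :: "'j \<Rightarrow> 'a \<Rightarrow> real" and I :: "'i set" and L :: real
  assumes P: "prob_space P" and I: "finite I" "I \<noteq> {}" and J: "finite J" "J \<noteq> {}"
    and t: "0 < t" and L: "0 < L"
    and X: "\<And>j. j \<in> J \<Longrightarrow> integrable P (X j)"
    and orlicz: "\<And>u. L2_set u J = 1 \<Longrightarrow>
      (\<integral>\<^sup>+ x. ennreal (exp (\<bar>\<Sum>j\<in>J. u j * X j x\<bar> ^ 2 / t ^ 2)) \<partial>P) \<le> 2"
  shows "measure (Pi\<^sub>M I (\<lambda>_. P)) {\<omega> \<in> space (Pi\<^sub>M I (\<lambda>_. P)).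
      real (card I) * (36 * t * (sqrt (card J / card I) + sqrt (L / card I)))
        < centered_sum_norm P J X I \<omega>} \<le> 2 * exp (- L)"
proof -
  interpret N: prob_space "Pi\<^sub>M I (\<lambda>_. P)"
    by (intro prob_space_PiM P)
  define N where "N = real (card I)"
  have N: "0 < N" using I by (simp add: N_def card_gt_0_iff)
  define m where "m = card J"
  have m: "0 < real m" using J by (simp add: m_def card_gt_0_iff)
  define L' where "L' = L + real m * ln 48"
  have L': "0 < L'" using L by (simp add: L'_def add_pos_nonneg)
  have L'_le: "L' \<le> 9 * (real m + L)" using net_union_bound(2)[of L m] L by (simp add: L'_def)
  define \<tau> where "\<tau> = N * (36 * t * (sqrt (m / N) + sqrt (L / N)))"
  have "sqrt (L' / N) \<le> sqrt (9 * (m / N + L / N))"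
    using L'_le N by (intro real_sqrt_le_mono) (simp add: divide_right_mono flip: add_divide_distrib)
  also have "\<dots> = 3 * sqrt (m / N + L / N)"
    by (simp only: real_sqrt_mult) simp
  also have "\<dots> \<le> 3 * (sqrt (m / N) + sqrt (L / N))"
    using m N L by (intro mult_left_mono sqrt_add_le_add_sqrt) auto
  finally have "12 * (sqrt m * (N * t)) * sqrt (L' / N) \<le>
      12 * (sqrt m * (N * t)) * (3 * (sqrt (m / N) + sqrt (L / N)))"
    using N t by (intro mult_left_mono) auto
  then have \<tau>: "N * ((2 * sqrt m * t) * (6 * sqrt (L' / N))) \<le> sqrt m * \<tau>"
    by (simp add: \<tau>_def mult_ac)
  have "measure (Pi\<^sub>M I (\<lambda>_. P)) {\<omega> \<in> space (Pi\<^sub>M I (\<lambda>_. P)). \<tau> < centered_sum_norm P J X I \<omega>}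
      \<le> 48 ^ card J * (2 * exp (- L'))"
  proof (rule centered_sum_norm_tail_net[OF P J X])
    fix z assume z: "z \<in> integer_ball J"
    define Y where "Y x = (\<Sum>j\<in>J. real_of_int (z j) * X j x)" for x
    have Y: "integrable P Y"
      unfolding Y_def using X by (intro Bochner_Integration.integrable_sum integrable_mult_right)
    have "measure (Pi\<^sub>M I (\<lambda>_. P)) {\<omega> \<in> space (Pi\<^sub>M I (\<lambda>_. P)).
        sqrt m * \<tau> < centered_sum_norm P {()} (\<lambda>_. Y) I \<omega>} \<le>
      measure (Pi\<^sub>M I (\<lambda>_. P)) {\<omega> \<in> space (Pi\<^sub>M I (\<lambda>_. P)).
        N * ((2 * sqrt m * t) * (6 * sqrt (L' / N))) < centered_sum_norm P {()} (\<lambda>_. Y) I \<omega>}"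
      using measurable_centered_sum_norm[of "{()}" "\<lambda>_. Y" P I] Y \<tau>
      by (intro N.finite_measure_mono) auto
    also have "\<dots> \<le> 2 * exp (- L')"
      unfolding N_def
      using orlicz_integer_ball[where q = 2, OF P J t _ orlicz z] Y m t L'
      by (intro sub_gaussian_tail P I) (auto simp: Y_def m_def)
    finally show "measure (Pi\<^sub>M I (\<lambda>_. P)) {\<omega> \<in> space (Pi\<^sub>M I (\<lambda>_. P)).
        sqrt (card J) * \<tau> < centered_sum_norm P {()} (\<lambda>_ x. \<Sum>j\<in>J. real_of_int (z j) * X j x) I \<omega>}
      \<le> 2 * exp (- L')"
      by (simp only: Y_def[abs_def] m_def)
  qed
  also have "\<dots> = 2 * exp (- L)"
    unfolding L'_def m_def by (rule net_union_bound)
  finally show ?thesis by (simp only: \<tau>_def N_def m_def)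
qed

text \<open>Strict inequalities in the events make those for \<open>t > K\<close> increase to the one for \<open>K\<close> as \<open>t\<close>
  decreases to \<open>K\<close>.\<close>

lemma (in prob_space) tail_at_infimum:
  fixes f :: "'a \<Rightarrow> real"
  assumes [measurable]: "f \<in> borel_measurable M" and c: "0 \<le> c"
    and b: "\<And>t. K < t \<Longrightarrow> measure M {\<omega> \<in> space M. c * t < f \<omega>} \<le> b"
  shows "measure M {\<omega> \<in> space M. c * K < f \<omega>} \<le> b"
proof -
  define A where "A n = {\<omega> \<in> space M. c * (K + inverse (real (Suc n))) < f \<omega>}" for n
  have [measurable]: "A n \<in> sets M" for n
    unfolding A_def by measurable
  have "incseq A"
  proof (rule incseq_SucI)
    fix n
    have "c * (K + inverse (real (Suc (Suc n)))) \<le> c * (K + inverse (real (Suc n)))"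
      using c by (intro mult_left_mono add_left_mono le_imp_inverse_le) auto
    then show "A n \<subseteq> A (Suc n)" by (auto simp: A_def)
  qed
  then have lim: "(\<lambda>n. measure M (A n)) \<longlonglongrightarrow> measure M (\<Union>n. A n)"
    by (intro finite_Lim_measure_incseq) auto
  have "(\<Union>n. A n) = {\<omega> \<in> space M. c * K < f \<omega>}"
  proof (intro equalityI subsetI)
    fix \<omega> assume "\<omega> \<in> (\<Union>n. A n)"
    then obtain n where w: "\<omega> \<in> space M" "c * (K + inverse (real (Suc n))) < f \<omega>" by (auto simp: A_def)
    have "c * K \<le> c * (K + inverse (real (Suc n)))" using c by (intro mult_left_mono) auto
    then show "\<omega> \<in> {\<omega> \<in> space M. c * K < f \<omega>}" using w by simp
  next
    fix \<omega> assume w: "\<omega> \<in> {\<omega> \<in> space M. c * K < f \<omega>}"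
    have "(\<lambda>n. c * (K + inverse (real (Suc n)))) \<longlonglongrightarrow> c * (K + 0)"
      by (intro tendsto_intros LIMSEQ_inverse_real_of_nat)
    then have "\<forall>\<^sub>F n in sequentially. c * (K + inverse (real (Suc n))) < f \<omega>"
      using w by (intro order_tendstoD) auto
    then obtain n where "c * (K + inverse (real (Suc n))) < f \<omega>"
      using eventually_happens trivial_limit_sequentially by blast
    then show "\<omega> \<in> (\<Union>n. A n)" using w by (auto simp: A_def)
  qed
  moreover have "measure M (A n) \<le> b" for n
    unfolding A_def by (rule b) simp
  ultimately show ?thesis
    using LIMSEQ_le_const2[OF lim, of b] by auto
qed

section \<open>Orlicz norms and symmetric vectorization\<close>

lemma psi_norm_lessD:
  assumes "psi_norm M q X < ennreal t"
  shows "(\<integral>\<^sup>+ \<omega>. ennreal (exp (\<bar>X \<omega>\<bar> ^ q / t ^ q)) \<partial>M) \<le> 2"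
proof -
  obtain s where s: "0 < s" "(\<integral>\<^sup>+ \<omega>. ennreal (exp (\<bar>X \<omega>\<bar> ^ q / s ^ q)) \<partial>M) \<le> 2" "ennreal s < ennreal t"
    using assms unfolding psi_norm_def INF_less_iff by blast
  then have "s \<le> t" by (simp add: ennreal_less_iff)
  then have "(\<integral>\<^sup>+ \<omega>. ennreal (exp (\<bar>X \<omega>\<bar> ^ q / t ^ q)) \<partial>M) \<le> (\<integral>\<^sup>+ \<omega>. ennreal (exp (\<bar>X \<omega>\<bar> ^ q / s ^ q)) \<partial>M)"
    using s(1) by (intro nn_integral_mono ennreal_leI) (simp add: divide_left_mono power_mono)
  then show ?thesis using s(2) by (rule order.trans)
qed

lemma (in prob_space) integrable_of_orlicz:
  fixes X :: "'a \<Rightarrow> real"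
  assumes X: "X \<in> borel_measurable M" and t: "0 < t" and q: "1 \<le> q"
    and orlicz: "(\<integral>\<^sup>+ \<omega>. ennreal (exp (\<bar>X \<omega>\<bar> ^ q / t ^ q)) \<partial>M) \<le> 2"
  shows "integrable M X"
proof (rule integrableI_bounded[OF X])
  have "(\<integral>\<^sup>+ \<omega>. ennreal (norm (X \<omega>)) \<partial>M) \<le> (\<integral>\<^sup>+ \<omega>. ennreal t * ennreal (exp (\<bar>X \<omega>\<bar> ^ q / t ^ q)) \<partial>M)"
  proof (rule nn_integral_mono)
    fix \<omega>
    define y where "y = \<bar>X \<omega>\<bar> / t"
    have y: "0 \<le> y" using t by (simp add: y_def)
    have "y \<le> exp (y ^ q)"
    proof (cases "y \<le> 1")
      case True
      have "1 \<le> exp (y ^ q)" using y by simp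
      with True show ?thesis by linarith
    next
      case False
      then have "y \<le> y ^ q" using q power_increasing[of 1 q y] by simp
      also have "\<dots> \<le> exp (y ^ q)" using exp_ge_add_one_self[of "y ^ q"] by linarith
      finally show ?thesis .
    qed
    then have "\<bar>X \<omega>\<bar> \<le> t * exp (\<bar>X \<omega>\<bar> ^ q / t ^ q)"
      using t by (simp add: y_def power_divide field_simps)
    then show "ennreal (norm (X \<omega>)) \<le> ennreal t * ennreal (exp (\<bar>X \<omega>\<bar> ^ q / t ^ q))"
      using t by (simp add: ennreal_mult'[symmetric])
  qed
  also have "\<dots> = ennreal t * (\<integral>\<^sup>+ \<omega>. ennreal (exp (\<bar>X \<omega>\<bar> ^ q / t ^ q)) \<partial>M)"
    using X by (intro nn_integral_cmult measurable_compose[OF _ measurable_ennreal]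
        measurable_compose[OF _ borel_measurable_exp] borel_measurable_divide borel_measurable_power
        borel_measurable_abs borel_measurable_const)
  also have "\<dots> \<le> ennreal t * 2"
    using orlicz by (rule mult_left_mono) simp
  also have "\<dots> < \<infinity>" by (simp add: ennreal_mult_less_top)
  finally show "(\<integral>\<^sup>+ \<omega>. ennreal (norm (X \<omega>)) \<partial>M) < \<infinity>" .
qed

lemma psi_norm_component:
  assumes P: "prob_space P" and i: "i \<in> I" and f [measurable]: "f \<in> borel_measurable P"
  shows "psi_norm (Pi\<^sub>M I (\<lambda>_. P)) q (\<lambda>\<omega>. f (\<omega> i)) = psi_norm P q f"
proof -
  interpret prob_space P by fact
  interpret product_prob_space "\<lambda>_. P" I ..
  have "(\<integral>\<^sup>+ \<omega>. ennreal (exp (\<bar>f (\<omega> i)\<bar> ^ q / t ^ q)) \<partial>Pi\<^sub>M I (\<lambda>_. P)) =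
      (\<integral>\<^sup>+ x. ennreal (exp (\<bar>f x\<bar> ^ q / t ^ q)) \<partial>P)" for t
  proof -
    have "(\<integral>\<^sup>+ x. ennreal (exp (\<bar>f x\<bar> ^ q / t ^ q)) \<partial>distr (Pi\<^sub>M I (\<lambda>_. P)) P (\<lambda>\<omega>. \<omega> i)) =
        (\<integral>\<^sup>+ \<omega>. ennreal (exp (\<bar>f (\<omega> i)\<bar> ^ q / t ^ q)) \<partial>Pi\<^sub>M I (\<lambda>_. P))"
      using i by (intro nn_integral_distr) measurable
    then show ?thesis using PiM_component[OF i] by simp
  qed
  then show ?thesis by (simp add: psi_norm_def)
qed

text \<open>The coordinates of \<open>svec\<close> as functionals on matrices of a given size; a list of functionals,
  unlike \<open>svec\<close> itself, makes measurability and linearity of the single coordinates visible.\<close>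

definition svec_coords :: "nat \<Rightarrow> (real mat \<Rightarrow> real) list" where
  "svec_coords n = [\<lambda>A. A $$ (i, i). i \<leftarrow> [0..<n]] @
     [\<lambda>A. sqrt 2 * A $$ (i, j). i \<leftarrow> [0..<n], j \<leftarrow> [Suc i..<n]]"

lemma svec_eq_coords:
  assumes "A \<in> carrier_mat n n"
  shows "svec A = vec_of_list (map (\<lambda>f. f A) (svec_coords n))"
  using assms by (simp add: svec_def svec_coords_def Let_def map_concat comp_def)

lemma length_svec_coords: "length (svec_coords n) = n * (n + 1) div 2"
proof -
  have "dim_vec (svec (0\<^sub>m n n)) = length (svec_coords n)"
    by (subst svec_eq_coords[of _ n]) auto
  then show ?thesis
    using svec_carrier[of "0\<^sub>m n n" n] by simp
qed

lemma svec_index: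
  assumes "A \<in> carrier_mat n n" "k < n * (n + 1) div 2"
  shows "svec A $ k = (svec_coords n ! k) A"
  using assms by (simp add: svec_eq_coords vec_of_list_index length_svec_coords)

lemma measurable_svec_index:
  assumes k: "k < n * (n + 1) div 2"
  shows "(\<lambda>A. svec A $ k) \<in> borel_measurable (borel_sym_mats n)"
proof -
  have "svec_coords n ! k \<in> set (svec_coords n)"
    using k by (simp add: length_svec_coords)
  then have "svec_coords n ! k \<in> borel_measurable (borel_sym_mats n)"
    by (auto simp: svec_coords_def intro!: borel_measurable_times measurable_entry)
  moreover have "svec A $ k = (svec_coords n ! k) A" if "A \<in> space (borel_sym_mats n)" for A
    using that k by (intro svec_index) (auto simp: sym_mats_def)
  ultimately show ?thesis
    by (subst measurable_cong) auto
qed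

lemma sum_square_split_diagonal:
  fixes b :: "nat \<Rightarrow> nat \<Rightarrow> 'a::comm_monoid_add"
  shows "(\<Sum>i<n. \<Sum>j<n. b i j) = (\<Sum>i<n. b i i) + (\<Sum>i<n. \<Sum>j\<in>{Suc i..<n}. b i j + b j i)"
proof (induction n)
  case (Suc n)
  have "(\<Sum>i<n. \<Sum>j\<in>{Suc i..<Suc n}. b i j + b j i) =
      (\<Sum>i<n. (\<Sum>j\<in>{Suc i..<n}. b i j + b j i) + (b i n + b n i))"
    by (intro sum.cong) auto
  then show ?case using Suc by (simp add: sum.distrib ac_simps)
qed simp

lemma sum_list_concat_map:
  "sum_list (concat (map f xs)) = sum_list (map (\<lambda>x. sum_list (f x)) xs)"
  by (induction xs) auto

text \<open>The factor \<open>sqrt 2\<close> in \<open>svec\<close> makes each off-diagonal entry count twice, as it does in the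
  Frobenius inner product.\<close>

lemma svec_inner:
  assumes A: "A \<in> sym_mats n" and B: "B \<in> sym_mats n"
  shows "(\<Sum>k<n * (n + 1) div 2. svec B $ k * svec A $ k) = (\<Sum>i<n. \<Sum>j<n. B $$ (i, j) * A $$ (i, j))"
proof -
  have AB: "A \<in> carrier_mat n n" "B \<in> carrier_mat n n"
    using A B by (auto simp: sym_mats_def)
  have sym: "C $$ (j, i) = C $$ (i, j)" if "C \<in> sym_mats n" "i < n" "j < n" for C i j
  proof -
    have "C\<^sup>T $$ (i, j) = C $$ (j, i)" using that by (intro index_transpose_mat) (auto simp: sym_mats_def)
    then show ?thesis using that by (simp add: sym_mats_def)
  qed
  have "(\<Sum>k<n * (n + 1) div 2. svec B $ k * svec A $ k) =
      (\<Sum>k<length (svec_coords n). (svec_coords n ! k) B * (svec_coords n ! k) A)"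
    using AB by (intro sum.cong) (auto simp: length_svec_coords svec_index)
  also have "\<dots> = sum_list (map (\<lambda>f. f B * f A) (svec_coords n))"
    by (simp add: sum_list_sum_nth atLeast0LessThan)
  also have "\<dots> = (\<Sum>i<n. B $$ (i, i) * A $$ (i, i)) +
      (\<Sum>i<n. \<Sum>j\<in>{Suc i..<n}. (sqrt 2 * B $$ (i, j)) * (sqrt 2 * A $$ (i, j)))"
    by (simp add: svec_coords_def map_concat sum_list_concat_map comp_def interv_sum_list_conv_sum_set_nat
        atLeast0LessThan)
  also have "(\<Sum>i<n. \<Sum>j\<in>{Suc i..<n}. (sqrt 2 * B $$ (i, j)) * (sqrt 2 * A $$ (i, j))) =
      (\<Sum>i<n. \<Sum>j\<in>{Suc i..<n}. B $$ (i, j) * A $$ (i, j) + B $$ (j, i) * A $$ (j, i))"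
    using sym[OF A] sym[OF B] by (intro sum.cong) auto
  also have "(\<Sum>i<n. B $$ (i, i) * A $$ (i, i)) + \<dots> = (\<Sum>i<n. \<Sum>j<n. B $$ (i, j) * A $$ (i, j))"
    by (rule sum_square_split_diagonal[symmetric])
  finally show ?thesis .
qed

text \<open>This transfers integrability from the coordinates of \<open>svec\<close> to the entries. The coefficients are
  those of the symmetrized matrix unit.\<close>

lemma entry_eq_svec_combination:
  assumes "i < n" "j < n"
  shows "\<exists>c. \<forall>A\<in>sym_mats n. A $$ (i, j) = (\<Sum>k<n * (n + 1) div 2. c k * svec A $ k)"
proof -
  define B :: "real mat" where "B = mat n n (\<lambda>(k, l).
    (if k = i then if l = j then 1 / 2 else 0 else 0) + (if k = j then if l = i then 1 / 2 else 0 else 0))"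
  have B: "B \<in> sym_mats n"
    by (auto simp: sym_mats_def B_def intro!: eq_matI)
  have "A $$ (i, j) = (\<Sum>k<n * (n + 1) div 2. svec B $ k * svec A $ k)" if A: "A \<in> sym_mats n" for A
  proof -
    have "A\<^sup>T $$ (i, j) = A $$ (j, i)"
      using A assms by (intro index_transpose_mat) (auto simp: sym_mats_def)
    then have sym: "A $$ (j, i) = A $$ (i, j)" using A by (simp add: sym_mats_def)
    have "(\<Sum>k<n. \<Sum>l<n. B $$ (k, l) * A $$ (k, l)) =
        (\<Sum>k<n. \<Sum>l<n. (if k = i then if l = j then A $$ (k, l) / 2 else 0 else 0) +
          (if k = j then if l = i then A $$ (k, l) / 2 else 0 else 0))"
      by (intro sum.cong) (auto simp: B_def)
    also have "\<dots> = (\<Sum>k<n. (if k = i then A $$ (k, j) / 2 else 0) + (if k = j then A $$ (k, i) / 2 else 0))"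
      using assms by (intro sum.cong) (auto simp: sum.distrib)
    also have "\<dots> = A $$ (i, j) / 2 + A $$ (j, i) / 2"
      using assms by (simp add: sum.distrib)
    finally show ?thesis unfolding svec_inner[OF A B] using sym by simp
  qed
  then show ?thesis by blast
qed

lemma scalar_prod_mult_mat_vec:
  fixes y :: "real vec"
  assumes "M \<in> carrier_mat n n" "y \<in> carrier_vec n"
  shows "y \<bullet> (M *\<^sub>v y) = (\<Sum>i<n. \<Sum>j<n. y $ i * y $ j * M $$ (i, j))"
proof -
  have "y \<bullet> (M *\<^sub>v y) = (\<Sum>i<n. \<Sum>j<n. y $ i * (M $$ (i, j) * y $ j))"
    using assms by (simp add: scalar_prod_def mult_mat_vec_def sum_distrib_left atLeast0LessThan)
  also have "\<dots> = (\<Sum>i<n. \<Sum>j<n. y $ i * y $ j * M $$ (i, j))"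
    by (simp add: mult_ac)
  finally show ?thesis .
qed

lemma unit_sphere_iff:
  "y \<in> unit_sphere n \<longleftrightarrow> y \<in> carrier_vec n \<and> (\<Sum>i<n. (y $ i)\<^sup>2) = 1"
  by (auto simp: unit_sphere_def scalar_prod_def atLeast0LessThan power2_eq_square)

lemma deviation_entry:
  assumes "i < n" "j < n"
  shows "(empirical_mean n N \<omega> - expectation_mat n P) $$ (i, j) =
    (\<Sum>k = 1..N. \<omega> k $$ (i, j)) / real N - (\<integral>A. A $$ (i, j) \<partial>P)"
  using assms by (simp add: empirical_mean_def expectation_mat_def)

lemma deviation_carrier: "empirical_mean n N \<omega> - expectation_mat n P \<in> carrier_mat n n"
  by (simp add: empirical_mean_def expectation_mat_def minus_carrier_mat)

lemma quadratic_form_le_centered_sum_norm: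
  fixes P :: "real mat measure"
  assumes sets_P: "sets P = sets (borel_sym_mats n)" and N: "1 \<le> N"
    and int: "\<And>k. k < n * (n + 1) div 2 \<Longrightarrow> integrable P (\<lambda>A. svec A $ k)"
    and \<omega>: "\<And>k. k \<in> {1..N} \<Longrightarrow> \<omega> k \<in> sym_mats n"
    and y: "y \<in> unit_sphere n"
  shows "y \<bullet> ((empirical_mean n N \<omega> - expectation_mat n P) *\<^sub>v y)
    \<le> centered_sum_norm P {..<n * (n + 1) div 2} (\<lambda>k A. svec A $ k) {1..N} \<omega> / real N"
proof -
  define m where "m = n * (n + 1) div 2"
  have space_P: "space P = sym_mats n"
    using sets_eq_imp_space_eq[OF sets_P] by simp
  have yc: "y \<in> carrier_vec n" and y1: "(\<Sum>i<n. (y $ i)\<^sup>2) = 1"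
    using y by (auto simp: unit_sphere_iff)
  define B where "B = mat n n (\<lambda>(i, j). y $ i * y $ j)"
  have B: "B \<in> sym_mats n"
    by (auto simp: B_def sym_mats_def mult.commute intro!: eq_matI)
  define c where "c k = svec B $ k" for k
  have q: "(\<Sum>i<n. \<Sum>j<n. y $ i * y $ j * A $$ (i, j)) = (\<Sum>k<m. c k * svec A $ k)"
    if "A \<in> sym_mats n" for A
  proof -
    have "(\<Sum>i<n. \<Sum>j<n. y $ i * y $ j * A $$ (i, j)) = (\<Sum>i<n. \<Sum>j<n. B $$ (i, j) * A $$ (i, j))"
      by (intro sum.cong) (auto simp: B_def)
    then show ?thesis unfolding c_def m_def svec_inner[OF that B] .
  qed
  have "(\<Sum>k<m. c k * c k) = (\<Sum>i<n. \<Sum>j<n. B $$ (i, j) * B $$ (i, j))"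
    unfolding c_def m_def by (rule svec_inner[OF B B])
  also have "\<dots> = (\<Sum>i<n. \<Sum>j<n. (y $ i)\<^sup>2 * (y $ j)\<^sup>2)"
    by (intro sum.cong) (auto simp: B_def power2_eq_square)
  also have "\<dots> = 1"
    by (simp add: sum_distrib_left[symmetric] y1)
  finally have c1: "L2_set c {..<m} = 1"
    by (simp add: L2_set_def power2_eq_square)
  have int_entry: "integrable P (\<lambda>A. A $$ (i, j))" if ij: "i < n" "j < n" for i j
  proof -
    obtain d where d: "\<And>A. A \<in> sym_mats n \<Longrightarrow> A $$ (i, j) = (\<Sum>k<m. d k * svec A $ k)"
      using entry_eq_svec_combination[OF ij] by (auto simp: m_def)
    have "integrable P (\<lambda>A. \<Sum>k<m. d k * svec A $ k)"
      using int by (intro Bochner_Integration.integrable_sum integrable_mult_right) (auto simp: m_def)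
    then show ?thesis
      using d by (subst Bochner_Integration.integrable_cong[OF refl]) (auto simp: space_P)
  qed
  let ?S = "\<lambda>k. \<Sum>i\<in>{1..N}. (svec (\<omega> i) $ k - (\<integral>A. svec A $ k \<partial>P))"
  have "(\<Sum>i<n. \<Sum>j<n. y $ i * y $ j * (\<integral>A. A $$ (i, j) \<partial>P)) =
      (\<Sum>i<n. \<integral>A. (\<Sum>j<n. y $ i * y $ j * A $$ (i, j)) \<partial>P)"
    using int_entry by (intro sum.cong refl) (simp add: Bochner_Integration.integral_sum)
  also have "\<dots> = (\<integral>A. (\<Sum>i<n. \<Sum>j<n. y $ i * y $ j * A $$ (i, j)) \<partial>P)"
    using int_entry by (intro Bochner_Integration.integral_sum[symmetric]
        Bochner_Integration.integrable_sum integrable_mult_right) auto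
  also have "\<dots> = (\<integral>A. (\<Sum>k<m. c k * svec A $ k) \<partial>P)"
    by (intro Bochner_Integration.integral_cong refl q) (simp add: space_P)
  also have "\<dots> = (\<Sum>k<m. c k * (\<integral>A. svec A $ k \<partial>P))"
    using int by (simp add: integral_sum m_def)
  finally have mean: "(\<Sum>i<n. \<Sum>j<n. y $ i * y $ j * (\<integral>A. A $$ (i, j) \<partial>P)) =
      (\<Sum>k<m. c k * (\<integral>A. svec A $ k \<partial>P))" .
  have "(\<Sum>i<n. \<Sum>j<n. y $ i * y $ j * (\<Sum>k = 1..N. \<omega> k $$ (i, j))) =
      (\<Sum>i<n. \<Sum>k = 1..N. \<Sum>j<n. y $ i * y $ j * \<omega> k $$ (i, j))"
    unfolding sum_distrib_left by (intro sum.cong[OF refl] sum.swap)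
  also have "\<dots> = (\<Sum>k = 1..N. \<Sum>i<n. \<Sum>j<n. y $ i * y $ j * \<omega> k $$ (i, j))"
    by (rule sum.swap)
  also have "\<dots> = (\<Sum>i = 1..N. \<Sum>k<m. c k * svec (\<omega> i) $ k)"
    using \<omega> by (intro sum.cong refl q) auto
  also have "\<dots> = (\<Sum>k<m. c k * (\<Sum>i = 1..N. svec (\<omega> i) $ k))"
    unfolding sum_distrib_left by (rule sum.swap)
  finally have emp: "(\<Sum>i<n. \<Sum>j<n. y $ i * y $ j * (\<Sum>k = 1..N. \<omega> k $$ (i, j))) =
      (\<Sum>k<m. c k * (\<Sum>i = 1..N. svec (\<omega> i) $ k))" .
  have "real N * (y \<bullet> ((empirical_mean n N \<omega> - expectation_mat n P) *\<^sub>v y)) =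
      real N * (\<Sum>i<n. \<Sum>j<n. y $ i * y $ j *
        ((\<Sum>k = 1..N. \<omega> k $$ (i, j)) / real N - (\<integral>A. A $$ (i, j) \<partial>P)))"
    by (simp add: scalar_prod_mult_mat_vec[OF deviation_carrier yc] deviation_entry)
  also have "\<dots> = (\<Sum>i<n. \<Sum>j<n. y $ i * y $ j * (\<Sum>k = 1..N. \<omega> k $$ (i, j))) -
      real N * (\<Sum>i<n. \<Sum>j<n. y $ i * y $ j * (\<integral>A. A $$ (i, j) \<partial>P))"
  proof -
    have "real N * (y $ i * y $ j * (e / real N - p)) = y $ i * y $ j * e - real N * (y $ i * y $ j * p)"
      for i j e p
      using N by (simp add: right_diff_distrib)
    then show ?thesis
      unfolding sum_distrib_left[of "real N"] by (simp only: sum_subtractf)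
  qed
  also have "\<dots> = (\<Sum>k<m. c k * ?S k)"
    unfolding mean emp by (simp add: sum_subtractf right_diff_distrib sum_distrib_left mult_ac)
  also have "\<dots> \<le> (\<Sum>k<m. \<bar>c k\<bar> * \<bar>?S k\<bar>)"
    by (intro sum_mono) (simp add: abs_mult[symmetric])
  also have "\<dots> \<le> L2_set c {..<m} * L2_set ?S {..<m}"
    by (rule L2_set_mult_ineq)
  also have "\<dots> = centered_sum_norm P {..<m} (\<lambda>k A. svec A $ k) {1..N} \<omega>"
    by (simp add: c1 centered_sum_norm_def)
  finally show ?thesis
    using N by (simp add: m_def field_simps)
qed

text \<open>By homogeneity the sphere can be replaced by all nonzero vectors, by continuity these by rational
  ones, and by homogeneity again by integer ones. Lists are used since they form a countable type;
  entries beyond the length of a list are unspecified integers, which does no harm.\<close>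

lemma quadratic_form_le_iff_integer:
  fixes M :: "nat \<Rightarrow> nat \<Rightarrow> real"
  shows "(\<forall>y. (\<Sum>i<n. (y i)\<^sup>2) = 1 \<longrightarrow> (\<Sum>i<n. \<Sum>j<n. y i * y j * M i j) \<le> b) \<longleftrightarrow>
    (\<forall>z :: int list. (\<Sum>i<n. \<Sum>j<n. real_of_int (z ! i) * real_of_int (z ! j) * M i j)
      \<le> b * (\<Sum>i<n. (real_of_int (z ! i))\<^sup>2))"
    (is "?L \<longleftrightarrow> ?R")
proof
  assume L: ?L
  show ?R
  proof
    fix z :: "int list"
    define r where "r = sqrt (\<Sum>i<n. (real_of_int (z ! i))\<^sup>2)"
    have r2: "(\<Sum>i<n. (real_of_int (z ! i))\<^sup>2) = r\<^sup>2" by (simp add: r_def sum_nonneg)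
    show "(\<Sum>i<n. \<Sum>j<n. real_of_int (z ! i) * real_of_int (z ! j) * M i j)
      \<le> b * (\<Sum>i<n. (real_of_int (z ! i))\<^sup>2)"
    proof (cases "r = 0")
      case True
      then have "z ! i = 0" if "i < n" for i
        using r2 that by (simp add: sum_nonneg_eq_0_iff)
      then show ?thesis by simp
    next
      case False
      define y where "y i = real_of_int (z ! i) / r" for i
      have "(\<Sum>i<n. (y i)\<^sup>2) = 1"
        using False by (simp add: y_def power_divide r2 flip: sum_divide_distrib)
      then have "(\<Sum>i<n. \<Sum>j<n. y i * y j * M i j) \<le> b" using L by blast
      moreover have "(\<Sum>i<n. \<Sum>j<n. real_of_int (z ! i) * real_of_int (z ! j) * M i j) =
          r\<^sup>2 * (\<Sum>i<n. \<Sum>j<n. y i * y j * M i j)"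
        using False by (simp add: y_def sum_distrib_left power2_eq_square)
      ultimately show ?thesis
        unfolding r2 by (simp add: mult.commute[of b] mult_left_mono)
    qed
  qed
next
  assume R: ?R
  show ?L
  proof (intro allI impI)
    fix y :: "nat \<Rightarrow> real" assume y: "(\<Sum>i<n. (y i)\<^sup>2) = 1"
    define r where "r k i = real_of_int \<lfloor>real (Suc k) * y i\<rfloor> / real (Suc k)" for k i
    have r: "(\<lambda>k. r k i) \<longlonglongrightarrow> y i" for i
    proof (rule real_tendsto_sandwich)
      have "(\<lambda>k. y i - inverse (real (Suc k))) \<longlonglongrightarrow> y i - 0"
        by (intro tendsto_intros LIMSEQ_inverse_real_of_nat)
      then show "(\<lambda>k. y i - inverse (real (Suc k))) \<longlonglongrightarrow> y i" by simp
      show "\<forall>\<^sub>F k in sequentially. y i - inverse (real (Suc k)) \<le> r k i"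
      proof (intro always_eventually allI)
        fix k
        have "real (Suc k) * y i - 1 \<le> real_of_int \<lfloor>real (Suc k) * y i\<rfloor>" by linarith
        then have "(real (Suc k) * y i - 1) / real (Suc k) \<le> r k i"
          unfolding r_def by (rule divide_right_mono) simp
        then show "y i - inverse (real (Suc k)) \<le> r k i"
          by (simp add: diff_divide_distrib inverse_eq_divide del: of_nat_Suc)
      qed
      show "\<forall>\<^sub>F k in sequentially. r k i \<le> y i"
      proof (intro always_eventually allI)
        fix k
        have "r k i \<le> (real (Suc k) * y i) / real (Suc k)"
          unfolding r_def by (rule divide_right_mono) simp_all
        then show "r k i \<le> y i" by (simp del: of_nat_Suc)
      qed
    qed simp
    have "(\<Sum>i<n. \<Sum>j<n. r k i * r k j * M i j) \<le> b * (\<Sum>i<n. (r k i)\<^sup>2)" for k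
    proof -
      define z where "z = map (\<lambda>i. \<lfloor>real (Suc k) * y i\<rfloor>) [0..<n]"
      define a where "a = real (Suc k)"
      have a: "0 < a" by (simp add: a_def)
      have z: "real_of_int (z ! i) = a * r k i" if "i < n" for i
        using that by (simp add: z_def r_def a_def del: of_nat_Suc)
      have "(\<Sum>i<n. \<Sum>j<n. (a * r k i) * (a * r k j) * M i j) \<le> b * (\<Sum>i<n. (a * r k i)\<^sup>2)"
        using R[rule_format, of z] by (simp add: z)
      then have "a\<^sup>2 * (\<Sum>i<n. \<Sum>j<n. r k i * r k j * M i j) \<le> a\<^sup>2 * (b * (\<Sum>i<n. (r k i)\<^sup>2))"
        by (simp add: sum_distrib_left power2_eq_square mult_ac)
      then show ?thesis using a by simp
    qed
    then have "(\<Sum>i<n. \<Sum>j<n. y i * y j * M i j) \<le> b * (\<Sum>i<n. (y i)\<^sup>2)"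
      by (intro LIMSEQ_le[of "\<lambda>k. \<Sum>i<n. \<Sum>j<n. r k i * r k j * M i j" _
            "\<lambda>k. b * (\<Sum>i<n. (r k i)\<^sup>2)"] tendsto_intros r) auto
    then show "(\<Sum>i<n. \<Sum>j<n. y i * y j * M i j) \<le> b" by (simp add: y)
  qed
qed

section \<open>The deviation of the empirical mean\<close>

lemma L2_set_unit_vector:
  fixes k m :: nat
  shows "k < m \<Longrightarrow> L2_set (\<lambda>i. if i = k then 1 else 0 :: real) {..<m} = 1"
  by (simp add: L2_set_def if_distrib[where f = "\<lambda>x. x\<^sup>2"] cong: if_cong)

lemma unit_sphere_image:
  assumes "L2_set u {..<m} = 1"
  shows "vec m u \<in> unit_sphere m"
  using assms by (auto simp: unit_sphere_iff L2_set_def)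

lemma l2_norm_eq_L2_set: "v \<in> carrier_vec m \<Longrightarrow> l2_norm v = L2_set (\<lambda>k. v $ k) {..<m}"
  by (auto simp: l2_norm_def L2_set_def scalar_prod_def atLeast0LessThan power2_eq_square)

text \<open>The bound \<open>c\<close> ensures that the supremum of reals is a genuine one. The right-hand side is a
  countable conjunction of measurable conditions.\<close>

lemma sup_deviation_le_iff:
  assumes n: "1 \<le> n" and bdd: "\<And>y. y \<in> unit_sphere n \<Longrightarrow>
    y \<bullet> ((empirical_mean n N \<omega> - expectation_mat n P) *\<^sub>v y) \<le> c"
  shows "sup_deviation n N P \<omega> \<le> b \<longleftrightarrow>
    (\<forall>z :: int list. (\<Sum>i<n. \<Sum>j<n. real_of_int (z ! i) * real_of_int (z ! j) *
        ((\<Sum>k = 1..N. \<omega> k $$ (i, j)) / real N - (\<integral>A. A $$ (i, j) \<partial>P)))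
      \<le> b * (\<Sum>i<n. (real_of_int (z ! i))\<^sup>2))"
proof -
  let ?M = "empirical_mean n N \<omega> - expectation_mat n P"
  let ?m = "\<lambda>i j. (\<Sum>k = 1..N. \<omega> k $$ (i, j)) / real N - (\<integral>A. A $$ (i, j) \<partial>P)"
  have "L2_set (\<lambda>i. if i = 0 then 1 else 0 :: real) {..<n} = 1"
    using n by (intro L2_set_unit_vector) simp
  from unit_sphere_image[OF this] have ne: "unit_sphere n \<noteq> {}" by blast
  have form: "y \<bullet> (?M *\<^sub>v y) = (\<Sum>i<n. \<Sum>j<n. y $ i * y $ j * ?m i j)" if "y \<in> carrier_vec n" for y
    by (simp add: scalar_prod_mult_mat_vec[OF deviation_carrier that] deviation_entry)
  have "sup_deviation n N P \<omega> \<le> b \<longleftrightarrow> (\<forall>y\<in>unit_sphere n. y \<bullet> (?M *\<^sub>v y) \<le> b)"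
    unfolding sup_deviation_def using ne bdd by (intro cSUP_le_iff) (auto simp: bdd_above_def)
  also have "\<dots> \<longleftrightarrow> (\<forall>y. (\<Sum>i<n. (y i)\<^sup>2) = 1 \<longrightarrow> (\<Sum>i<n. \<Sum>j<n. y i * y j * ?m i j) \<le> b)"
  proof (intro iffI ballI allI impI)
    fix y :: "nat \<Rightarrow> real"
    assume *: "\<forall>y\<in>unit_sphere n. y \<bullet> (?M *\<^sub>v y) \<le> b" and "(\<Sum>i<n. (y i)\<^sup>2) = 1"
    then have "vec n y \<in> unit_sphere n" by (simp add: unit_sphere_iff)
    with * show "(\<Sum>i<n. \<Sum>j<n. y i * y j * ?m i j) \<le> b"
      using form[of "vec n y"] by auto
  next
    fix y assume *: "\<forall>y. (\<Sum>i<n. (y i)\<^sup>2) = 1 \<longrightarrow> (\<Sum>i<n. \<Sum>j<n. y i * y j * ?m i j) \<le> b"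
      and "y \<in> unit_sphere n"
    then have y: "y \<in> carrier_vec n" "(\<Sum>i<n. (y $ i)\<^sup>2) = 1"
      by (simp_all add: unit_sphere_iff)
    with * show "y \<bullet> (?M *\<^sub>v y) \<le> b"
      unfolding form[OF y(1)] by blast
  qed
  finally show ?thesis
    by (simp only: quadratic_form_le_iff_integer)
qed

lemma sup_deviation_prob_ge:
  fixes P :: "real mat measure"
  assumes P: "prob_space P" and sets_P: "sets P = sets (borel_sym_mats n)" and n: "1 \<le> n" and N: "1 \<le> N"
    and int: "\<And>k. k < n * (n + 1) div 2 \<Longrightarrow> integrable P (\<lambda>A. svec A $ k)"
    and tail: "measure (sample_law N P) {\<omega> \<in> space (sample_law N P).
      real N * b < centered_sum_norm P {..<n * (n + 1) div 2} (\<lambda>k A. svec A $ k) {1..N} \<omega>} \<le> \<beta>"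
  shows "measure (sample_law N P) {\<omega> \<in> space (sample_law N P). sup_deviation n N P \<omega> \<le> b} \<ge> 1 - \<beta>"
proof -
  interpret S: prob_space "sample_law N P"
    unfolding sample_law_def by (intro prob_space_PiM P)
  let ?X = "\<lambda>k A. svec A $ k"
  let ?F = "centered_sum_norm P {..<n * (n + 1) div 2} ?X {1..N}"
  have F [measurable]: "?F \<in> borel_measurable (sample_law N P)"
    unfolding sample_law_def using int by (intro measurable_centered_sum_norm) auto
  have space_P: "space P = sym_mats n"
    using sets_eq_imp_space_eq[OF sets_P] by simp
  have \<omega>: "\<omega> k \<in> sym_mats n" if "\<omega> \<in> space (sample_law N P)" "k \<in> {1..N}" for \<omega> k
    using that by (auto simp: sample_law_def space_PiM space_P)
  have quad: "y \<bullet> ((empirical_mean n N \<omega> - expectation_mat n P) *\<^sub>v y) \<le> ?F \<omega> / real N"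
    if "\<omega> \<in> space (sample_law N P)" "y \<in> unit_sphere n" for \<omega> y
    using that \<omega> by (intro quadratic_form_le_centered_sum_norm sets_P N int) auto
  let ?A = "{\<omega> \<in> space (sample_law N P). sup_deviation n N P \<omega> \<le> b}"
  let ?T = "{\<omega> \<in> space (sample_law N P). real N * b < ?F \<omega>}"
  let ?Q = "\<lambda>z \<omega>. (\<Sum>i<n. \<Sum>j<n. real_of_int (z ! i) * real_of_int (z ! j) *
    ((\<Sum>k = 1..N. \<omega> k $$ (i, j)) / real N - (\<integral>A. A $$ (i, j) \<partial>P)))"
  have entry: "(\<lambda>\<omega>. \<omega> k $$ (i, j)) \<in> borel_measurable (sample_law N P)"
    if "k \<in> {1..N}" "i < n" "j < n" for k i j
  proof -
    have "(\<lambda>A. A $$ (i, j)) \<in> borel_measurable P"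
      using measurable_entry[OF that(2,3)] by (simp add: measurable_cong_sets[OF sets_P refl])
    then show ?thesis
      unfolding sample_law_def
      using measurable_component_singleton[OF that(1), of "\<lambda>_. P"] by (rule measurable_compose[rotated])
  qed
  have Q [measurable]: "?Q z \<in> borel_measurable (sample_law N P)" for z :: "int list"
    by (intro borel_measurable_sum borel_measurable_times borel_measurable_const borel_measurable_diff
        borel_measurable_divide entry) auto
  have "?A = {\<omega> \<in> space (sample_law N P). \<forall>z :: int list. ?Q z \<omega> \<le> b * (\<Sum>i<n. (real_of_int (z ! i))\<^sup>2)}"
    by (intro Collect_cong conj_cong refl sup_deviation_le_iff[OF n quad])
  also have "\<dots> \<in> sets (sample_law N P)"
    by measurable
  finally have A: "?A \<in> sets (sample_law N P)" .
  have T: "?T \<in> sets (sample_law N P)" by measurable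
  have "space (sample_law N P) - ?T \<subseteq> ?A"
  proof
    fix \<omega> assume w: "\<omega> \<in> space (sample_law N P) - ?T"
    then have "?F \<omega> / real N \<le> b" using N by (auto simp: field_simps not_less)
    moreover have "sup_deviation n N P \<omega> \<le> ?F \<omega> / real N"
      unfolding sup_deviation_def
    proof (rule cSUP_least)
      have "L2_set (\<lambda>i. if i = 0 then 1 else 0 :: real) {..<n} = 1"
        using n by (intro L2_set_unit_vector) simp
      from unit_sphere_image[OF this] show "unit_sphere n \<noteq> {}" by blast
    qed (use w quad in auto)
    ultimately show "\<omega> \<in> ?A" using w by auto
  qed
  then have "measure (sample_law N P) (space (sample_law N P) - ?T) \<le> measure (sample_law N P) ?A"
    using A by (rule S.finite_measure_mono)
  then show ?thesis
    using tail S.prob_compl[OF T] by simp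
qed

lemma psi_norm_vec_sample_law:
  assumes P: "prob_space P" and sets_P: "sets P = sets (borel_sym_mats n)" and i: "i \<in> {1..N}"
    and m: "m = n * (n + 1) div 2"
  shows "psi_norm_vec (sample_law N P) q m (\<lambda>\<omega>. svec (\<omega> i)) = psi_norm_vec P q m svec"
proof -
  have "psi_norm (sample_law N P) q (\<lambda>\<omega>. u \<bullet> svec (\<omega> i)) = psi_norm P q (\<lambda>A. u \<bullet> svec A)" for u
  proof -
    have space_P: "space P = sym_mats n"
      using sets_eq_imp_space_eq[OF sets_P] by simp
    have "u \<bullet> svec A = (\<Sum>k<m. u $ k * svec A $ k)" if "A \<in> space P" for A
      using that svec_carrier[of A n]
      by (simp add: space_P sym_mats_def scalar_prod_def m atLeast0LessThan)
    moreover have "(\<lambda>A. \<Sum>k<m. u $ k * svec A $ k) \<in> borel_measurable P"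
      using measurable_svec_index[of _ n] by (intro borel_measurable_sum borel_measurable_times borel_measurable_const)
        (auto simp: m measurable_cong_sets[OF sets_P refl])
    ultimately have "(\<lambda>A. u \<bullet> svec A) \<in> borel_measurable P"
      by (subst measurable_cong) auto
    then show ?thesis
      unfolding sample_law_def by (rule psi_norm_component[OF P i])
  qed
  then show ?thesis by (simp add: psi_norm_vec_def)
qed

lemma max_psi_norm_eq:
  assumes P: "prob_space P" and sets_P: "sets P = sets (borel_sym_mats n)" and N: "1 \<le> N"
    and m: "m = n * (n + 1) div 2"
  shows "max_psi_norm q m N P = enn2real (psi_norm_vec P q m svec)"
proof -
  have "(\<lambda>i. psi_norm_vec (sample_law N P) q m (\<lambda>\<omega>. svec (\<omega> i))) ` {1..N} = {psi_norm_vec P q m svec}"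
    using N psi_norm_vec_sample_law[OF P sets_P _ m] by (auto simp: image_iff)
  then show ?thesis by (simp add: max_psi_norm_def)
qed

lemma psi_norm_vec_lessD:
  assumes P: "prob_space P" and sets_P: "sets P = sets (borel_sym_mats n)"
    and m: "m = n * (n + 1) div 2" and q: "1 \<le> q"
    and fin: "psi_norm_vec P q m svec < \<infinity>" and t: "enn2real (psi_norm_vec P q m svec) < t"
  shows "L2_set u {..<m} = 1 \<Longrightarrow>
      (\<integral>\<^sup>+ A. ennreal (exp (\<bar>\<Sum>k<m. u k * svec A $ k\<bar> ^ q / t ^ q)) \<partial>P) \<le> 2"
    and "k < m \<Longrightarrow> integrable P (\<lambda>A. svec A $ k)"
proof -
  interpret prob_space P by fact
  have space_P: "space P = sym_mats n"
    using sets_eq_imp_space_eq[OF sets_P] by simp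
  have "0 < t" using t enn2real_nonneg by (rule le_less_trans[rotated])
  have lt: "psi_norm_vec P q m svec < ennreal t"
    using fin t by (metis enn2real_nonneg ennreal_enn2real ennreal_less_iff infinity_ennreal_def)
  show orlicz: "(\<integral>\<^sup>+ A. ennreal (exp (\<bar>\<Sum>k<m. u k * svec A $ k\<bar> ^ q / t ^ q)) \<partial>P) \<le> 2"
    if u: "L2_set u {..<m} = 1" for u
  proof -
    have "psi_norm P q (\<lambda>A. vec m u \<bullet> svec A) \<le> psi_norm_vec P q m svec"
      unfolding psi_norm_vec_def by (intro SUP_upper unit_sphere_image u)
    also note lt
    finally have "(\<integral>\<^sup>+ A. ennreal (exp (\<bar>vec m u \<bullet> svec A\<bar> ^ q / t ^ q)) \<partial>P) \<le> 2"
      by (rule psi_norm_lessD)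
    also have "(\<integral>\<^sup>+ A. ennreal (exp (\<bar>vec m u \<bullet> svec A\<bar> ^ q / t ^ q)) \<partial>P) =
        (\<integral>\<^sup>+ A. ennreal (exp (\<bar>\<Sum>k<m. u k * svec A $ k\<bar> ^ q / t ^ q)) \<partial>P)"
    proof (rule nn_integral_cong)
      fix A assume "A \<in> space P"
      then have "svec A \<in> carrier_vec m"
        using svec_carrier[of A n] by (simp add: space_P sym_mats_def m)
      then show "ennreal (exp (\<bar>vec m u \<bullet> svec A\<bar> ^ q / t ^ q)) =
          ennreal (exp (\<bar>\<Sum>k<m. u k * svec A $ k\<bar> ^ q / t ^ q))"
        by (simp add: scalar_prod_def atLeast0LessThan)
    qed
    finally show ?thesis .
  qed
  show "integrable P (\<lambda>A. svec A $ k)" if k: "k < m"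
  proof (rule integrable_of_orlicz[OF _ \<open>0 < t\<close> q])
    show "(\<lambda>A. svec A $ k) \<in> borel_measurable P"
      using measurable_svec_index[of k n] k by (simp add: m measurable_cong_sets[OF sets_P refl])
    have "L2_set (\<lambda>i. if i = k then 1 else 0 :: real) {..<m} = 1"
      using k by (intro L2_set_unit_vector) simp
    from orlicz[OF this] show "(\<integral>\<^sup>+ A. ennreal (exp (\<bar>svec A $ k\<bar> ^ q / t ^ q)) \<partial>P) \<le> 2"
      using k by (simp add: if_distrib[where f = "\<lambda>x. x * _"] cong: if_cong)
  qed
qed

theorem theoremB5:
  shows "\<exists>C > 0. \<forall>(n :: nat) (N :: nat) (m :: nat) (P :: real mat measure) (\<beta> :: real).
    1 \<le> n \<longrightarrow> 1 \<le> N \<longrightarrow> m = n * (n + 1) div 2 \<longrightarrow>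
    prob_space P \<longrightarrow> sets P = sets (borel_sym_mats n) \<longrightarrow>
    0 < \<beta> \<longrightarrow> \<beta> < 1 \<longrightarrow>
    ((\<forall>i\<in>{1..N}. sub_exponential_vec (sample_law N P) m (\<lambda>\<omega>. svec (\<omega> i))) \<longrightarrow>
       measure (sample_law N P) {\<omega> \<in> space (sample_law N P).
         sup_deviation n N P \<omega> \<le> C * max_psi_norm 1 m N P *
           (sqrt ((real m + ln (2 / \<beta>)) / real N) + (real m + ln (2 / \<beta>)) / real N)} \<ge> 1 - \<beta>
     \<and>
       (\<forall>R > 0. (\<forall>i\<in>{1..N}. psi_norm (sample_law N P) 1 (\<lambda>\<omega>. l2_norm (svec (\<omega> i))) \<le> ennreal R) \<longrightarrow>
         measure (sample_law N P) {\<omega> \<in> space (sample_law N P).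
           sup_deviation n N P \<omega> \<le> 2 * sqrt 2 * R * sqrt (2 * ln (2 / \<beta>) / real N) +
             R * ln (2 / \<beta>) / real N} \<ge> 1 - \<beta>))
    \<and>
    ((\<forall>i\<in>{1..N}. sub_gaussian_vec (sample_law N P) m (\<lambda>\<omega>. svec (\<omega> i))) \<longrightarrow>
       measure (sample_law N P) {\<omega> \<in> space (sample_law N P).
         sup_deviation n N P \<omega> \<le> C * max_psi_norm 2 m N P *
           (sqrt (real m / real N) + sqrt (ln (2 / \<beta>) / real N))} \<ge> 1 - \<beta>)"
proof (intro exI[of _ 36] conjI allI impI)
  show "(0::real) < 36" by simp
next
  fix n N m :: nat and P :: "real mat measure" and \<beta> :: real
  assume n: "1 \<le> n" and N: "1 \<le> N" and m: "m = n * (n + 1) div 2"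
    and P: "prob_space P" and sets_P: "sets P = sets (borel_sym_mats n)"
    and \<beta>: "0 < \<beta>" "\<beta> < 1"
  interpret S: prob_space "sample_law N P"
    unfolding sample_law_def by (intro prob_space_PiM P)
  let ?X = "\<lambda>k A. svec A $ k"
  let ?F = "centered_sum_norm P {..<m} ?X {1..N}"
  let ?tail = "\<lambda>b. measure (sample_law N P) {\<omega> \<in> space (sample_law N P). b < ?F \<omega>}"
  define L where "L = ln (2 / \<beta>)"
  have L: "0 < L" and exp_L: "2 * exp (- L) = \<beta>"
    using \<beta> by (auto simp: L_def exp_minus)
  have "n * (n + 1) \<ge> 2" using n mult_le_mono[of 1 n 2 "n + 1"] by simp
  then have m0: "0 < m" unfolding m by simp
  have one: "1 \<in> {1..N}" using N by simp
  have space_P: "space P = sym_mats n"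
    using sets_eq_imp_space_eq[OF sets_P] by simp
  have X: "?X k \<in> borel_measurable P" if "k < m" for k
    using measurable_svec_index[of k n] that by (simp add: m measurable_cong_sets[OF sets_P refl])
  have F: "?F \<in> borel_measurable (sample_law N P)"
    unfolding sample_law_def using X by (intro measurable_centered_sum_norm) auto
  have conclude: "measure (sample_law N P) {\<omega> \<in> space (sample_law N P). sup_deviation n N P \<omega> \<le> c * K} \<ge> 1 - \<beta>"
    if "0 \<le> c" and tail: "\<And>t. K < t \<Longrightarrow> ?tail (real N * (c * t)) \<le> \<beta>" and int: "\<And>k. k < m \<Longrightarrow> integrable P (?X k)" for c K
  proof (rule sup_deviation_prob_ge[OF P sets_P n N])
    have "?tail ((real N * c) * K) \<le> \<beta>"
    proof (rule S.tail_at_infimum[OF F])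
      show "?tail (real N * c * t) \<le> \<beta>" if "K < t" for t
        using tail[OF that] by (simp only: mult.assoc)
    qed (use that(1) in simp)
    then show "measure (sample_law N P) {\<omega> \<in> space (sample_law N P).
        real N * (c * K) < centered_sum_norm P {..<n * (n + 1) div 2} ?X {1..N} \<omega>} \<le> \<beta>"
      unfolding m[symmetric] mult.assoc .
    show "integrable P (?X k)" if "k < n * (n + 1) div 2" for k
      using that(1) unfolding m[symmetric] by (rule int)
  qed
  {
    assume "\<forall>i\<in>{1..N}. sub_exponential_vec (sample_law N P) m (\<lambda>\<omega>. svec (\<omega> i))"
    then have fin: "psi_norm_vec P 1 m svec < \<infinity>"
      using psi_norm_vec_sample_law[OF P sets_P one m, of 1]
      unfolding sub_exponential_vec_def by (metis one)
    define K where "K = enn2real (psi_norm_vec P 1 m svec)"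
    have K: "max_psi_norm 1 m N P = K"
      unfolding K_def by (rule max_psi_norm_eq[OF P sets_P N m])
    have K0: "0 \<le> K" by (simp add: K_def)
    have int: "integrable P (?X k)" if "k < m" for k
      using psi_norm_vec_lessD(2)[OF P sets_P m _ fin, of "K + 1" k] that by (simp add: K_def)
    show "measure (sample_law N P) {\<omega> \<in> space (sample_law N P).
        sup_deviation n N P \<omega> \<le> 36 * max_psi_norm 1 m N P *
          (sqrt ((real m + ln (2 / \<beta>)) / real N) + (real m + ln (2 / \<beta>)) / real N)} \<ge> 1 - \<beta>"
    proof -
      define g where "g = sqrt ((real m + L) / real N) + (real m + L) / real N"
      have "0 \<le> g" using L N by (simp add: g_def)
      moreover have "?tail (real N * ((36 * g) * t)) \<le> \<beta>" if t: "K < t" for t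
        using sub_exponential_norm_tail[where X = ?X and J = "{..<m}" and I = "{1..N}" and t = t and L = L,
          OF P _ _ _ _ _ L int psi_norm_vec_lessD(1)[OF P sets_P m _ fin t[unfolded K_def]]]
          t K0 m0 N by (simp add: g_def sample_law_def exp_L lessThan_empty_iff mult_ac)
      ultimately have "measure (sample_law N P)
          {\<omega> \<in> space (sample_law N P). sup_deviation n N P \<omega> \<le> (36 * g) * K} \<ge> 1 - \<beta>"
        using int by (intro conclude) auto
      then show ?thesis by (simp only: K g_def L_def mult_ac)
    qed
    fix R :: real
    assume R: "0 < R"
      and "\<forall>i\<in>{1..N}. psi_norm (sample_law N P) 1 (\<lambda>\<omega>. l2_norm (svec (\<omega> i))) \<le> ennreal R"
    then have R1: "psi_norm (sample_law N P) 1 (\<lambda>\<omega>. l2_norm (svec (\<omega> 1))) \<le> ennreal R"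
      using one by blast
    have l2: "l2_norm (svec A) = L2_set (\<lambda>k. ?X k A) {..<m}" if "A \<in> space P" for A
      using that svec_carrier[of A n] by (intro l2_norm_eq_L2_set) (simp add: space_P sym_mats_def m)
    have l2m: "(\<lambda>A. l2_norm (svec A)) \<in> borel_measurable P"
      using l2 borel_measurable_L2_set[of "{..<m}" ?X P] X by (subst measurable_cong) auto
    have psi: "psi_norm P 1 (\<lambda>A. l2_norm (svec A)) \<le> ennreal R"
      using R1 psi_norm_component[OF P one l2m] by (simp add: sample_law_def)
    show "measure (sample_law N P) {\<omega> \<in> space (sample_law N P).
        sup_deviation n N P \<omega> \<le> 2 * sqrt 2 * R * sqrt (2 * ln (2 / \<beta>) / real N) +
          R * ln (2 / \<beta>) / real N} \<ge> 1 - \<beta>"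
    proof -
      define g where "g = 4 * sqrt (L / real N) + L / real N"
      have "0 \<le> g" using L N by (simp add: g_def)
      moreover have "?tail (real N * (g * t)) \<le> \<beta>" if t: "R < t" for t
      proof -
        have "psi_norm P 1 (\<lambda>A. l2_norm (svec A)) < ennreal t"
          using psi t R by (simp add: le_less_trans ennreal_less_iff)
        then have "(\<integral>\<^sup>+ A. ennreal (exp (\<bar>l2_norm (svec A)\<bar> ^ 1 / t ^ 1)) \<partial>P) \<le> 2"
          by (rule psi_norm_lessD)
        also have "(\<integral>\<^sup>+ A. ennreal (exp (\<bar>l2_norm (svec A)\<bar> ^ 1 / t ^ 1)) \<partial>P) =
            (\<integral>\<^sup>+ A. ennreal (exp (L2_set (\<lambda>k. ?X k A) {..<m} / t)) \<partial>P)"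
          by (intro nn_integral_cong) (simp add: l2)
        finally show ?thesis
          using sub_exponential_tail[where X = ?X and J = "{..<m}" and I = "{1..N}" and t = t and L = L,
            OF P _ _ _ _ L int] t R N by (simp add: g_def sample_law_def exp_L mult_ac)
      qed
      ultimately have "measure (sample_law N P)
          {\<omega> \<in> space (sample_law N P). sup_deviation n N P \<omega> \<le> g * R} \<ge> 1 - \<beta>"
        using int by (intro conclude) auto
      moreover have "2 * sqrt 2 * R * sqrt (2 * L / real N) + R * L / real N = g * R"
      proof -
        have "sqrt (2 * L / real N) = sqrt 2 * sqrt (L / real N)"
          by (simp add: real_sqrt_mult[symmetric])
        then have "2 * sqrt 2 * R * sqrt (2 * L / real N) = 2 * (sqrt 2 * sqrt 2) * R * sqrt (L / real N)"
          by (simp only: mult_ac)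
        then show ?thesis by (simp add: g_def algebra_simps)
      qed
      ultimately show ?thesis by (simp only: L_def)
    qed
  }
  {
    assume "\<forall>i\<in>{1..N}. sub_gaussian_vec (sample_law N P) m (\<lambda>\<omega>. svec (\<omega> i))"
    then have fin: "psi_norm_vec P 2 m svec < \<infinity>"
      using psi_norm_vec_sample_law[OF P sets_P one m, of 2]
      unfolding sub_gaussian_vec_def by (metis one)
    define K where "K = enn2real (psi_norm_vec P 2 m svec)"
    have K: "max_psi_norm 2 m N P = K"
      unfolding K_def by (rule max_psi_norm_eq[OF P sets_P N m])
    have K0: "0 \<le> K" by (simp add: K_def)
    have int: "integrable P (?X k)" if "k < m" for k
      using psi_norm_vec_lessD(2)[OF P sets_P m _ fin, of "K + 1" k] that by (simp add: K_def)
    show "measure (sample_law N P) {\<omega> \<in> space (sample_law N P).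
        sup_deviation n N P \<omega> \<le> 36 * max_psi_norm 2 m N P *
          (sqrt (real m / real N) + sqrt (ln (2 / \<beta>) / real N))} \<ge> 1 - \<beta>"
    proof -
      define g where "g = sqrt (real m / real N) + sqrt (L / real N)"
      have "0 \<le> g" using L N by (simp add: g_def)
      moreover have "?tail (real N * ((36 * g) * t)) \<le> \<beta>" if t: "K < t" for t
        using sub_gaussian_norm_tail[where X = ?X and J = "{..<m}" and I = "{1..N}" and t = t and L = L,
          OF P _ _ _ _ _ L int psi_norm_vec_lessD(1)[OF P sets_P m _ fin t[unfolded K_def]]]
          t K0 m0 N by (simp add: g_def sample_law_def exp_L lessThan_empty_iff mult_ac)
      ultimately have "measure (sample_law N P)
          {\<omega> \<in> space (sample_law N P). sup_deviation n N P \<omega> \<le> (36 * g) * K} \<ge> 1 - \<beta>"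
        using int by (intro conclude) auto
      then show ?thesis by (simp only: K g_def L_def mult_ac)
    qed
  }
qed

end
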